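(* Let $r\ge1$ be an integer, $\nu$ fixed with $\Re(\nu)>-\frac1{r+1}$, $a<b$, $f,g\in C^\infty[a,b]$, with $g(a)=0$, $g^{(j)}(a)=0$ for $j=1,\dots,r$, $g^{(r+1)}(a)\ne0$, and $g(x)\ne0$, $g'(x)\ne0$ for $x\in(a,b]$. Let $\mathcal{H}_\nu[f]=\int_a^bf(x)J_\nu(\omega g(x))\,dx$, $M_j(a,\nu,\omega)=\int_a^b(x-a)^jJ_\nu(\omega g(x))\,dx$, $T_r[\phi](x,y)=\sum_{j=0}^r\frac{\phi^{(j)}(y)}{j!}(x-y)^j$, and $\widehat\sigma_0[f]=f$, $\widehat\sigma_k[f](x)=g(x)^{\nu+k}\frac{d}{dx}\left[\frac{\widehat\sigma_{k-1}[f](x)-T_r[\widehat\sigma_{k-1}[f]](x,a)}{g(x)^{\nu+k}g'(x)}\right]$ for $k\ge1$ (values at $a$ by continuous extension). Then, as $\omega\to\infty$, $$\mathcal{H}_\nu[f]\sim\sum_{k=0}^\infty\frac{1}{(-\omega)^k}\sum_{j=0}^r\frac{\widehat\sigma_k[f]^{(j)}(a)}{j!}M_j(a,\nu+k,\omega)-\sum_{k=1}^\infty\frac{1}{(-\omega)^k}\left[\frac{\widehat\sigma_{k-1}[f](b)-T_r[\widehat\sigma_{k-1}[f]](b,a)}{g'(b)}\right]J_{\nu+k}(\omega g(b)).$$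
   Context: $J_\nu$ is the Bessel function of the first kind of order $\nu$; $\sim$ denotes an asymptotic expansion as $\omega\to\infty$. *)

theory Defs
  imports "HOL-Analysis.Analysis" "HOL-Library.Landau_Symbols"
begin

text \<open>Bessel function of the first kind, principal branch of (z/2)^nu,
  written with the reciprocal Gamma function so that integer orders are covered.\<close>
definition besselJ :: "complex \<Rightarrow> complex \<Rightarrow> complex" where
  "besselJ \<nu> z =
     (if \<nu> = 0 then 1 else (z / 2) powr \<nu>) *
     (\<Sum>m. (-1) ^ m * (z / 2) ^ (2 * m) * rGamma (\<nu> + of_nat m + 1) / fact m)"

definition dwithin :: "real \<Rightarrow> real \<Rightarrow> (real \<Rightarrow> 'a::real_normed_vector) \<Rightarrow> real \<Rightarrow> 'a" where
  "dwithin a b h x = vector_derivative h (at x within {a..b})"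

definition nderiv :: "real \<Rightarrow> real \<Rightarrow> nat \<Rightarrow> (real \<Rightarrow> 'a::real_normed_vector) \<Rightarrow> real \<Rightarrow> 'a" where
  "nderiv a b j h = (dwithin a b ^^ j) h"

definition smooth_on_interval :: "real \<Rightarrow> real \<Rightarrow> (real \<Rightarrow> 'a::real_normed_vector) \<Rightarrow> bool" where
  "smooth_on_interval a b h \<longleftrightarrow>
     (\<forall>j. \<forall>x\<in>{a..b}. (nderiv a b j h has_vector_derivative nderiv a b (Suc j) h x) (at x within {a..b}))"

definition taylor_poly :: "real \<Rightarrow> real \<Rightarrow> nat \<Rightarrow> (real \<Rightarrow> complex) \<Rightarrow> real \<Rightarrow> real \<Rightarrow> complex" where
  "taylor_poly a b r \<phi> x y = (\<Sum>j\<le>r. nderiv a b j \<phi> y / fact j * of_real ((x - y) ^ j))"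

fun sigma_hat :: "real \<Rightarrow> real \<Rightarrow> nat \<Rightarrow> complex \<Rightarrow> (real \<Rightarrow> real) \<Rightarrow> (real \<Rightarrow> real) \<Rightarrow> nat \<Rightarrow> real \<Rightarrow> complex" where
  "sigma_hat a b r \<nu> g f 0 = (\<lambda>x. complex_of_real (f x))"
| "sigma_hat a b r \<nu> g f (Suc k) =
    (let s = sigma_hat a b r \<nu> g f k;
         Q = (\<lambda>x. (s x - taylor_poly a b r s x a) /
                  (complex_of_real (g x) powr (\<nu> + of_nat (Suc k)) * complex_of_real (dwithin a b g x)));
         e = (\<lambda>x. complex_of_real (g x) powr (\<nu> + of_nat (Suc k)) * dwithin a b Q x)
     in (\<lambda>x. if x = a then Lim (at_right a) e else e x))"

definition hankel_H :: "real \<Rightarrow> real \<Rightarrow> complex \<Rightarrow> (real \<Rightarrow> real) \<Rightarrow> (real \<Rightarrow> real) \<Rightarrow> real \<Rightarrow> complex" where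
  "hankel_H a b \<nu> g f \<omega> = integral {a..b} (\<lambda>x. complex_of_real (f x) * besselJ \<nu> (complex_of_real (\<omega> * g x)))"

definition moment_M :: "real \<Rightarrow> real \<Rightarrow> (real \<Rightarrow> real) \<Rightarrow> nat \<Rightarrow> complex \<Rightarrow> real \<Rightarrow> complex" where
  "moment_M a b g j \<nu> \<omega> = integral {a..b} (\<lambda>x. complex_of_real ((x - a) ^ j) * besselJ \<nu> (complex_of_real (\<omega> * g x)))"

end

theory Submission
  imports Defs
begin

text \<open>Let \<open>\<mu> = \<nu> + k\<close>. Since \<open>z\<^bsup>\<mu>+1\<^esup> J\<^bsub>\<mu>+1\<^esub>(z)\<close> has derivative \<open>z\<^bsup>\<mu>+1\<^esup> J\<^bsub>\<mu>\<^esub>(z)\<close>, one integration by parts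
  turns the integral of \<open>(\<sigma>\<^sub>k - T\<^sub>r[\<sigma>\<^sub>k]) J\<^bsub>\<mu>\<^esub>(\<omega> g)\<close> into \<open>1 / \<omega>\<close> times a boundary term at \<open>b\<close> minus the
  integral of \<open>\<sigma>\<^bsub>k+1\<^esub> J\<^bsub>\<mu>+1\<^esub>(\<omega> g)\<close>. Subtracting the Taylor polynomial makes the boundary term at \<open>a\<close>
  vanish and keeps \<open>\<sigma>\<^bsub>k+1\<^esub>\<close> smooth: \<open>g = (x - a)\<^bsup>r+1\<^esup> p\<close> and \<open>g' = (x - a)\<^bsup>r\<^esup> q\<close> with zero-free smooth
  \<open>p\<close>, \<open>q\<close>, so all quotients extend smoothly to \<open>a\<close>. The remainder after \<open>N\<close> steps is \<open>(-\<omega>)\<^bsup>-N\<^esup>\<close> times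
  such an integral, and one further integration by parts bounds it, as \<open>J\<^bsub>\<mu>+1\<^esub>\<close> is bounded on the real
  line.\<close>

subsection \<open>Bessel functions on the real line\<close>

text \<open>The entire factor of the Bessel function: J_mu(z) = (z/2)^mu F_mu(-(z/2)^2). All
  multivaluedness sits in the power, and F depends on z only through z^2.\<close>

definition besselF :: "complex \<Rightarrow> complex \<Rightarrow> complex" where
  "besselF \<mu> u = (\<Sum>m. rGamma (\<mu> + of_nat m + 1) / fact m * u ^ m)"

lemma summable_besselF: "summable (\<lambda>m. rGamma (\<mu> + of_nat m + 1) / fact m * u ^ m :: complex)"
proof (rule summable_ratio_test)
  \<comment> \<open>Consecutive terms differ by the factor u / ((n + 1) (mu + n + 1)). This
    \<open>N\<close> forces |mu + n + 1| >= 1 and 2 |u| <= n + 1, so the factor is at most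
    1/2.\<close>
  define N where "N = nat \<lceil>2 * norm u + norm \<mu> + 1\<rceil>"
  show "norm (rGamma (\<mu> + of_nat (Suc n) + 1) / fact (Suc n) * u ^ Suc n)
      \<le> 1/2 * norm (rGamma (\<mu> + of_nat n + 1) / fact n * u ^ n)" if "n \<ge> N" for n
  proof -
    have n: "real n \<ge> 2 * norm u + norm \<mu> + 1"
      using that unfolding N_def by linarith
    define z where "z = \<mu> + of_nat n + 1"
    have "real n + 1 = norm (z - \<mu>)"
      unfolding z_def by (metis add.commute add.left_commute add_diff_cancel_left' norm_of_nat of_nat_Suc add.assoc)
    also have "\<dots> \<le> norm z + norm \<mu>" by (rule norm_triangle_ineq4)
    finally have nz: "norm z \<ge> 1" using n norm_ge_zero[of u] by linarith
    have "rGamma z = z * rGamma (z + 1)" by (simp add: rGamma_plus1)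
    then have "norm (rGamma (z + 1)) \<le> norm (rGamma z)"
      using nz mult_right_mono[of 1 "norm z" "norm (rGamma (z + 1))"] by (simp add: norm_mult)
    moreover have "norm u / real (Suc n) \<le> 1/2"
    proof -
      have "0 \<le> norm u" "0 \<le> norm \<mu>" by auto
      then have "norm u * 2 \<le> real n + 1" using n by linarith
      then show ?thesis by (simp add: divide_le_eq)
    qed
    ultimately have "norm (rGamma (z + 1)) * (norm u / real (Suc n)) \<le> norm (rGamma z) * (1/2)"
      by (intro mult_mono) auto
    then have "norm (rGamma (z + 1)) * (norm u / real (Suc n)) * (norm u ^ n / fact n)
        \<le> norm (rGamma z) * (1/2) * (norm u ^ n / fact n)"
      by (intro mult_right_mono) auto
    moreover have "\<mu> + of_nat (Suc n) + 1 = z + 1" by (simp add: z_def algebra_simps)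
    ultimately show ?thesis
      by (simp only: z_def[symmetric])
        (simp add: norm_mult norm_divide norm_power mult_ac flip: of_nat_Suc)
  qed
qed simp

text \<open>Termwise differentiation cancels n + 1 against the factorial, and the index shift raises
  the order by one.\<close>

lemma besselF_has_field_derivative:
  "(besselF \<mu> has_field_derivative besselF (\<mu> + 1) u) (at u)"
proof -
  have d: "diffs (\<lambda>m. rGamma (\<mu> + of_nat m + 1) / fact m) n = rGamma ((\<mu> + 1) + of_nat n + 1) / fact n" for n
    by (simp add: diffs_def field_simps del: of_nat_Suc) (simp add: algebra_simps)
  show ?thesis
    unfolding besselF_def[abs_def] d[symmetric]
    by (rule termdiffs_strong_converges_everywhere) (rule summable_besselF)
qed

lemma continuous_on_besselF: "continuous_on A (besselF \<mu>)"
  by (meson DERIV_isCont besselF_has_field_derivative continuous_at_imp_continuous_on)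

text \<open>Comes from rGamma(mu + m) = (mu + m) rGamma(mu + m + 1): the mu part sums to mu F_mu,
  the m part to u F_(mu+1). It is J_(mu-1) + J_(mu+1) = (2 mu / z) J_mu without the powers.\<close>

lemma besselF_recurrence: "besselF (\<mu> - 1) u = \<mu> * besselF \<mu> u + u * besselF (\<mu> + 1) u"
proof -
  let ?a = "\<lambda>m. rGamma (\<mu> + of_nat m + 1) / fact m"
  have sh: "of_nat (Suc m) * ?a (Suc m) * u ^ Suc m
      = u * (rGamma ((\<mu> + 1) + of_nat m + 1) / fact m * u ^ m)" for m
    by (simp add: field_simps del: of_nat_Suc) (simp add: algebra_simps)
  have "(\<lambda>m. of_nat (Suc m) * ?a (Suc m) * u ^ Suc m) sums (u * besselF (\<mu> + 1) u)"
    unfolding sh besselF_def by (intro sums_mult summable_sums summable_besselF)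
  then have 1: "(\<lambda>m. of_nat m * ?a m * u ^ m) sums (u * besselF (\<mu> + 1) u)"
    by (subst (asm) sums_Suc_iff) simp
  have 2: "(\<lambda>m. \<mu> * (?a m * u ^ m)) sums (\<mu> * besselF \<mu> u)"
    unfolding besselF_def by (intro sums_mult summable_sums summable_besselF)
  have "rGamma (\<mu> - 1 + of_nat m + 1) = (\<mu> + of_nat m) * rGamma (\<mu> + of_nat m + 1)" for m
    by (simp add: rGamma_plus1)
  then have "(\<lambda>m. rGamma (\<mu> - 1 + of_nat m + 1) / fact m * u ^ m)
      = (\<lambda>m. \<mu> * (?a m * u ^ m) + of_nat m * ?a m * u ^ m)"
    by (simp add: fun_eq_iff field_simps)
  then show ?thesis
    using sums_add[OF 2 1] unfolding besselF_def[of "\<mu> - 1"] by (simp add: sums_iff)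
qed

lemma besselJ_eq_besselF:
  "besselJ \<mu> z = (if \<mu> = 0 then 1 else (z / 2) powr \<mu>) * besselF \<mu> (- ((z / 2)\<^sup>2))"
proof -
  have "(-1) ^ m * (z / 2) ^ (2 * m) = (- ((z / 2)\<^sup>2)) ^ m" for m
    by (metis power_minus power_mult)
  then show ?thesis
    unfolding besselJ_def besselF_def by (simp add: mult_ac)
qed

section \<open>Differentiation along the real axis\<close>

lemma has_vector_derivative_of_real_powr:
  assumes "y \<noteq> 0"
  shows "((\<lambda>y. complex_of_real y powr c) has_vector_derivative c * of_real y powr (c - 1)) (at y)"
proof (cases "y > 0")
  case True
  then have "((\<lambda>z. z powr c) has_field_derivative c * of_real y powr (c - 1)) (at (complex_of_real y))"
    by (intro has_field_derivative_powr) auto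
  then show ?thesis
    by (rule has_vector_derivative_real_field)
next
  case False
  then have y: "y < 0" using assms by auto
  \<comment> \<open>Negative reals lie on the branch cut, where the complex power need not be
    differentiable. Along the real line it is a constant multiple of (-x)^d, which is. The case is
    needed because g may be negative.\<close>
  have neg: "complex_of_real x powr d = exp (\<i> * pi * d) * of_real (- x) powr d" if "x < 0" for x d
    using that by (simp add: powr_def Ln_minus exp_add[symmetric] algebra_simps Ln_of_real'[symmetric])
  have "((\<lambda>z. z powr c) has_field_derivative c * of_real (- y) powr (c - 1)) (at (complex_of_real (- y)))"
    using y by (intro has_field_derivative_powr) auto
  then have "((\<lambda>x. of_real x powr c) has_vector_derivative c * of_real (- y) powr (c - 1)) (at (- y))"
    by (rule has_vector_derivative_real_field)
  then have "((\<lambda>x. of_real x powr c) \<circ> uminus has_vector_derivative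
      (-1) *\<^sub>R (c * of_real (- y) powr (c - 1))) (at y)"
    by (intro vector_diff_chain_at) (auto intro!: derivative_eq_intros)
  then have "((\<lambda>x. exp (\<i> * pi * c) * of_real (- x) powr c) has_vector_derivative
      exp (\<i> * pi * c) * (- (c * of_real (- y) powr (c - 1)))) (at y)"
    by (intro has_vector_derivative_mult_right) (simp add: o_def)
  \<comment> \<open>exp(i pi) = -1 absorbs the sign produced by the reflection.\<close>
  moreover have "exp (\<i> * pi * c) * (- (c * of_real (- y) powr (c - 1))) = c * of_real y powr (c - 1)"
    using neg[OF y, of "c - 1"] by (simp add: right_diff_distrib exp_diff)
  ultimately have d: "((\<lambda>x. exp (\<i> * pi * c) * of_real (- x) powr c) has_vector_derivative
      c * of_real y powr (c - 1)) (at y)"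
    by simp
  show ?thesis
    using d by (rule has_vector_derivative_transform_within_open[of _ _ _ "{..<0}"]) (use y neg in auto)
qed

text \<open>The product rule on power times \<open>besselF\<close> gives the first formula, and
  \<open>besselF_recurrence\<close> turns it into the second. The second, at order mu + 1, drives
  the integration by parts; the two together give Bessel's equation.\<close>

lemma besselJ_of_real_derivatives:
  assumes "y \<noteq> 0"
  shows "((\<lambda>y. besselJ \<mu> (of_real y)) has_vector_derivative
      \<mu> / of_real y * besselJ \<mu> (of_real y) - besselJ (\<mu> + 1) (of_real y)) (at y)" (is ?d1)
    and "((\<lambda>y. besselJ \<mu> (of_real y)) has_vector_derivative
      besselJ (\<mu> - 1) (of_real y) - \<mu> / of_real y * besselJ \<mu> (of_real y)) (at y)" (is ?d2)
proof -
  \<comment> \<open>Off zero the separate clause for order 0 in \<open>besselJ\<close> agrees with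
    the power; it matters only at z = 0, where \<open>powr\<close> returns 0.\<close>
  have rep: "besselJ \<mu> (of_real x) = of_real (x / 2) powr \<mu> * besselF \<mu> (of_real (- ((x / 2)\<^sup>2)))"
    if "x \<noteq> 0" for x \<mu>
    using that by (simp add: besselJ_eq_besselF)
  define P where "P = complex_of_real (y / 2) powr \<mu>"
  have P1: "complex_of_real (y / 2) powr (\<mu> + 1) = P * (of_real y / 2)"
    and P2: "complex_of_real (y / 2) powr (\<mu> - 1) = P / (of_real y / 2)"
    using assms by (simp_all add: P_def powr_add powr_diff)
  have "((\<lambda>x. complex_of_real x powr \<mu>) \<circ> (\<lambda>x. x / 2) has_vector_derivative
      (1/2) *\<^sub>R (\<mu> * of_real (y / 2) powr (\<mu> - 1))) (at y)"
    using assms by (intro vector_diff_chain_at has_vector_derivative_of_real_powr)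
      (auto intro!: derivative_eq_intros simp: has_real_derivative_iff_has_vector_derivative[symmetric])
  moreover have "(1/2) *\<^sub>R (\<mu> * of_real (y / 2) powr (\<mu> - 1)) = \<mu> / of_real y * P"
    unfolding P2 by (simp add: scaleR_conv_of_real)
  ultimately have dP: "((\<lambda>x. complex_of_real (x / 2) powr \<mu>) has_vector_derivative \<mu> / of_real y * P) (at y)"
    by (simp add: o_def)
  have "((\<lambda>x. besselF \<mu> (of_real x)) \<circ> (\<lambda>x. - ((x / 2)\<^sup>2)) has_vector_derivative
      (- (y / 2)) *\<^sub>R besselF (\<mu> + 1) (of_real (- ((y / 2)\<^sup>2)))) (at y)"
    by (intro vector_diff_chain_at has_vector_derivative_real_field besselF_has_field_derivative)
      (auto intro!: derivative_eq_intros simp: has_real_derivative_iff_has_vector_derivative[symmetric])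
  then have dF: "((\<lambda>x. besselF \<mu> (of_real (- ((x / 2)\<^sup>2)))) has_vector_derivative
      - (of_real y / 2) * besselF (\<mu> + 1) (of_real (- ((y / 2)\<^sup>2)))) (at y)"
    by (simp add: o_def scaleR_conv_of_real)
  have "((\<lambda>x. complex_of_real (x / 2) powr \<mu> * besselF \<mu> (of_real (- ((x / 2)\<^sup>2)))) has_vector_derivative
      \<mu> / of_real y * besselJ \<mu> (of_real y) - besselJ (\<mu> + 1) (of_real y)) (at y)"
    by (rule has_vector_derivative_eq_rhs[OF has_vector_derivative_mult[OF dP dF]])
      (use P1 in \<open>simp add: rep[OF assms] P_def algebra_simps\<close>)
  then show d1: ?d1
    by (rule has_vector_derivative_transform_within_open[of _ _ _ "- {0}"]) (use assms rep in auto)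
  have "besselJ (\<mu> - 1) (of_real y) - \<mu> / of_real y * besselJ \<mu> (of_real y)
      = \<mu> / of_real y * besselJ \<mu> (of_real y) - besselJ (\<mu> + 1) (of_real y)"
    unfolding rep[OF assms] P1 P2 P_def[symmetric] besselF_recurrence[of \<mu>]
    using assms by (simp add: field_simps power2_eq_square)
  then show ?d2
    using d1 by simp
qed

section \<open>Bounds near the origin and on the whole real line\<close>

lemma norm_of_real_powr_le:
  "norm (complex_of_real y powr c) \<le> \<bar>y\<bar> powr Re c * exp (pi * \<bar>Im c\<bar>)"
proof (cases "y = 0")
  case False
  \<comment> \<open>The modulus of y^c is the exponential of this real part; the argument of y
    contributes at most pi |Im c|.\<close>
  have "Re (c * Ln (of_real y)) = Re c * ln \<bar>y\<bar> - Im c * Im (Ln (of_real y))"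
    using False by (simp add: Re_Ln)
  also have "- (Im c * Im (Ln (of_real y))) \<le> \<bar>Im c\<bar> * \<bar>Im (Ln (of_real y))\<bar>"
    by (metis abs_ge_minus_self abs_mult)
  then have "Re c * ln \<bar>y\<bar> - Im c * Im (Ln (of_real y)) \<le> Re c * ln \<bar>y\<bar> + \<bar>Im c\<bar> * pi"
    using mult_left_mono[OF _ abs_ge_zero[of "Im c"], of "\<bar>Im (Ln (of_real y))\<bar>" pi]
      Im_Ln_le_pi[of "of_real y"] mpi_less_Im_Ln[of "of_real y"] False by (simp add: abs_le_iff)
  finally show ?thesis
    using False by (simp add: powr_def exp_add[symmetric] mult_ac)
qed auto

text \<open>\<open>besselF\<close> is bounded on a compact disc containing -(y/2)^2 for all |y| <=
  Y, so only the power factor remains. Used for continuity at 0 and for integrability at the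
  endpoint a.\<close>

lemma besselJ_of_real_le:
  obtains C where "C \<ge> 0"
    "\<And>y. \<bar>y\<bar> \<le> Y \<Longrightarrow> y \<noteq> 0 \<Longrightarrow> norm (besselJ \<mu> (of_real y)) \<le> C * \<bar>y\<bar> powr Re \<mu>"
proof -
  have "compact (cball 0 (Y\<^sup>2) :: complex set)" by simp
  from compact_imp_bounded[OF compact_continuous_image[OF continuous_on_besselF this]]
  obtain B where B: "\<And>u. u \<in> cball 0 (Y\<^sup>2) \<Longrightarrow> norm (besselF \<mu> u) \<le> B"
    unfolding bounded_iff by blast
  have B0: "B \<ge> 0" using B[of 0] norm_ge_zero order_trans by (metis centre_in_cball zero_le_power2)
  let ?C = "(1/2) powr Re \<mu> * exp (pi * \<bar>Im \<mu>\<bar>) * B"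
  show ?thesis
  proof (rule that[of ?C])
    fix y :: real assume y: "\<bar>y\<bar> \<le> Y" "y \<noteq> 0"
    have "norm (besselF \<mu> (- ((of_real y / 2)\<^sup>2))) \<le> B"
    proof (rule B)
      have "\<bar>y / 2\<bar>\<^sup>2 \<le> Y\<^sup>2" using y by (intro power_mono) auto
      then show "- ((of_real y / 2)\<^sup>2) \<in> cball (0::complex) (Y\<^sup>2)"
        by (simp add: norm_power norm_divide power_divide)
    qed
    moreover have "norm (complex_of_real (y / 2) powr \<mu>) \<le> \<bar>y / 2\<bar> powr Re \<mu> * exp (pi * \<bar>Im \<mu>\<bar>)"
      by (rule norm_of_real_powr_le)
    moreover have "besselJ \<mu> (of_real y) = of_real (y / 2) powr \<mu> * besselF \<mu> (- ((of_real y / 2)\<^sup>2))"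
      using y by (simp add: besselJ_eq_besselF)
    ultimately have "norm (besselJ \<mu> (of_real y)) \<le> (\<bar>y / 2\<bar> powr Re \<mu> * exp (pi * \<bar>Im \<mu>\<bar>)) * B"
      by (simp add: norm_mult mult_mono)
    also have "\<dots> = ?C * \<bar>y\<bar> powr Re \<mu>"
      by (simp add: powr_mult[of "1/2" "\<bar>y\<bar>", simplified] powr_divide field_simps)
    finally show "norm (besselJ \<mu> (of_real y)) \<le> ?C * \<bar>y\<bar> powr Re \<mu>" .
  qed (use B0 in auto)
qed

lemma besselJ_0_right: "\<mu> \<noteq> 0 \<Longrightarrow> besselJ \<mu> 0 = 0"
  by (simp add: besselJ_eq_besselF)

lemma continuous_on_besselJ_of_real:
  assumes "0 < Re \<mu>"
  shows "continuous_on A (\<lambda>y. besselJ \<mu> (of_real y))"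
proof -
  have "isCont (\<lambda>y. besselJ \<mu> (of_real y)) y" for y :: real
  proof (cases "y = 0")
    case False
    then show ?thesis
      using besselJ_of_real_derivatives(1) has_vector_derivative_continuous by blast
  next
    case True
    obtain C where C: "C \<ge> 0"
      "\<And>y. \<bar>y\<bar> \<le> 1 \<Longrightarrow> y \<noteq> 0 \<Longrightarrow> norm (besselJ \<mu> (of_real y)) \<le> C * \<bar>y\<bar> powr Re \<mu>"
      using besselJ_of_real_le[of 1 \<mu>] by metis
    have "((\<lambda>y. besselJ \<mu> (of_real y)) \<longlongrightarrow> 0) (at (0::real))"
    proof (rule Lim_null_comparison)
      show "\<forall>\<^sub>F y in at 0. norm (besselJ \<mu> (of_real y)) \<le> C * \<bar>y\<bar> powr Re \<mu>"
        unfolding eventually_at by (rule exI[of _ 1]) (auto intro: C)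
      have "((\<lambda>y. C * \<bar>y::real\<bar> powr Re \<mu>) \<longlongrightarrow> C * \<bar>0\<bar> powr Re \<mu>) (at 0)"
        using assms by (intro tendsto_intros tendsto_powr') auto
      then show "((\<lambda>y. C * \<bar>y::real\<bar> powr Re \<mu>) \<longlongrightarrow> 0) (at 0)" by simp
    qed
    moreover have "besselJ \<mu> 0 = 0" using assms by (intro besselJ_0_right) auto
    ultimately show ?thesis using True by (simp add: isCont_def)
  qed
  then show ?thesis by (simp add: continuous_at_imp_continuous_on)
qed

text \<open>The entire factor is even in the argument, so only the power picks up a constant. Bounds
  thereby carry over to the negative half-axis.\<close>

lemma besselJ_minus_of_real:
  assumes "y > 0"
  shows "besselJ \<mu> (of_real (- y)) = exp (\<i> * pi * \<mu>) * besselJ \<mu> (of_real y)"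
proof -
  have "complex_of_real (- y / 2) powr \<mu> = exp (\<i> * pi * \<mu>) * of_real (y / 2) powr \<mu>"
    using assms Ln_minus[of "of_real (y/2)"] Ln_of_real[of "y/2"]
    by (simp add: powr_def algebra_simps exp_add[symmetric])
  then show ?thesis
    using assms by (simp add: besselJ_eq_besselF)
qed

text \<open>The energy \<open>|J|\<^sup>2 + |J'|\<^sup>2\<close> has derivative at most \<open>|\<mu>|\<^sup>2 / y\<^sup>2\<close> times itself by Bessel's
  equation, so multiplied by \<open>exp (|\<mu>|\<^sup>2 / y)\<close> it decreases on the positive axis.\<close>
lemma bounded_besselJ_ge_1: "\<exists>B. \<forall>y\<ge>1. norm (besselJ \<mu> (of_real y)) \<le> B"
proof -
  define J where "J = (\<lambda>y::real. besselJ \<mu> (of_real y))"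
  define J' where "J' = (\<lambda>y::real. besselJ (\<mu> - 1) (of_real y) - \<mu> / of_real y * J y)"
  \<comment> \<open>Bessel's equation solved for the second derivative; \<open>dJ'\<close> verifies
    it from the two first-order formulas.\<close>
  define J'' where "J'' = (\<lambda>y::real. - J' y / of_real y + (\<mu>\<^sup>2 / of_real (y\<^sup>2) - 1) * J y)"
  define E where "E = (\<lambda>y. J y \<bullet> J y + J' y \<bullet> J' y)"
  define c where "c = (norm \<mu>)\<^sup>2"
  define G where "G = (\<lambda>y. exp (c / y) * E y)"
  have dJ: "(J has_vector_derivative J' y) (at y)" if "y > 0" for y
    using besselJ_of_real_derivatives(2)[of y \<mu>] that unfolding J'_def J_def by auto
  have dJ': "(J' has_vector_derivative J'' y) (at y)" if "y > 0" for y
  proof -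
    have "((\<lambda>z. \<mu> / z) has_field_derivative - \<mu> / (of_real y)\<^sup>2) (at (complex_of_real y))"
      using that by (auto intro!: derivative_eq_intros simp: power2_eq_square)
    then have inv: "((\<lambda>x. \<mu> / of_real x) has_vector_derivative - \<mu> / (of_real y)\<^sup>2) (at y)"
      by (rule has_vector_derivative_real_field)
    have "(J' has_vector_derivative ((\<mu> - 1) / of_real y * besselJ (\<mu> - 1) (of_real y) - J y)
        - (\<mu> / of_real y * J' y + - \<mu> / (of_real y)\<^sup>2 * J y)) (at y)"
      unfolding J'_def[abs_def]
      using that besselJ_of_real_derivatives(1)[of y "\<mu> - 1"] inv dJ[OF that]
      by (intro has_vector_derivative_diff has_vector_derivative_mult) (auto simp: J_def J'_def)
    moreover have "((\<mu> - 1) / of_real y * besselJ (\<mu> - 1) (of_real y) - J y)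
        - (\<mu> / of_real y * J' y + - \<mu> / (of_real y)\<^sup>2 * J y) = J'' y"
      using that unfolding J''_def J'_def by (simp add: field_simps power2_eq_square)
    ultimately show ?thesis by simp
  qed
  define E' where "E' = (\<lambda>y. 2 * (J y \<bullet> J' y) + 2 * (J' y \<bullet> J'' y))"
  have dE: "(E has_real_derivative E' y) (at y)" if "y > 0" for y
  proof -
    have "(E has_vector_derivative (J y \<bullet> J' y + J' y \<bullet> J y) + (J' y \<bullet> J'' y + J'' y \<bullet> J' y)) (at y)"
      unfolding E_def
      by (intro has_vector_derivative_add bounded_bilinear.has_vector_derivative[OF bounded_bilinear_inner]
          dJ dJ' that)
    then show ?thesis
      unfolding has_real_derivative_iff_has_vector_derivative E'_def by (simp add: inner_commute)
  qed
  have E'_le: "E' y \<le> c / y\<^sup>2 * E y" if "y > 0" for y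
  proof -
    \<comment> \<open>E' is twice the inner product of J' with J + J''. The -J inside J'' cancels J,
      leaving a damping term of favourable sign and a term of size |mu|^2 / y^2, which is integrable
      at infinity.\<close>
    have "J y + J'' y = - (inverse y *\<^sub>R J' y) + (\<mu>\<^sup>2 / of_real (y\<^sup>2)) * J y"
      by (simp add: J''_def algebra_simps scaleR_conv_of_real divide_simps)
    then have "E' y = - (2 / y * (J' y \<bullet> J' y)) + 2 * (J' y \<bullet> (\<mu>\<^sup>2 / of_real (y\<^sup>2) * J y))"
      unfolding E'_def inner_commute[of "J y"] distrib_left[symmetric] inner_add_right[symmetric]
      by (simp only: inner_add_right inner_minus_right inner_scaleR_right) (simp add: divide_simps)
    also have "\<dots> \<le> 2 * (J' y \<bullet> (\<mu>\<^sup>2 / of_real (y\<^sup>2) * J y))"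
      using that by simp
    also have "J' y \<bullet> (\<mu>\<^sup>2 / of_real (y\<^sup>2) * J y) \<le> norm (J' y) * norm (\<mu>\<^sup>2 / of_real (y\<^sup>2) * J y)"
      by (rule norm_cauchy_schwarz)
    also have "\<dots> = c / y\<^sup>2 * (norm (J' y) * norm (J y))"
      by (simp add: c_def norm_mult norm_divide norm_power)
    also have "2 * (c / y\<^sup>2 * (norm (J' y) * norm (J y))) = c / y\<^sup>2 * (2 * norm (J' y) * norm (J y))"
      by simp
    also have "\<dots> \<le> c / y\<^sup>2 * ((norm (J' y))\<^sup>2 + (norm (J y))\<^sup>2)"
      by (intro mult_left_mono sum_squares_bound) (simp add: c_def)
    also have "\<dots> = c / y\<^sup>2 * E y"
      by (simp add: E_def power2_norm_eq_inner add.commute)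
    finally show ?thesis by simp
  qed
  have dG: "(G has_real_derivative exp (c / y) * (E' y - c / y\<^sup>2 * E y)) (at y)" if "y > 0" for y
  proof -
    have "((\<lambda>y. c / y) has_real_derivative - c / y\<^sup>2) (at y)"
      using that by (auto intro!: derivative_eq_intros simp: power2_eq_square)
    from DERIV_mult[OF DERIV_fun_exp[OF this] dE[OF that]] show ?thesis
      unfolding G_def by (simp add: algebra_simps)
  qed
  have G_le: "G y \<le> G 1" if "y \<ge> 1" for y
  proof (rule DERIV_nonpos_imp_nonincreasing[OF that])
    fix x :: real assume "1 \<le> x" "x \<le> y"
    then show "\<exists>d. (G has_real_derivative d) (at x) \<and> d \<le> 0"
      using dG[of x] E'_le[of x] by (intro exI conjI) (auto simp: mult_le_0_iff)
  qed
  have "norm (J y) \<le> sqrt (G 1)" if "y \<ge> 1" for y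
  proof (rule real_le_rsqrt)
    have E0: "(norm (J y))\<^sup>2 \<le> E y" "E y \<ge> 0"
      by (simp_all add: E_def power2_norm_eq_inner)
    have "1 \<le> exp (c / y)" using that by (simp add: c_def)
    then have "1 * E y \<le> G y" unfolding G_def using E0 by (intro mult_right_mono)
    then show "(norm (J y))\<^sup>2 \<le> G 1" using E0 G_le[OF that] by linarith
  qed
  then show ?thesis unfolding J_def by blast
qed

text \<open>Three ranges: the energy bound for y >= 1, continuity on the compact [-1, 1] (this needs
  Re mu > 0), and reflection for y <= -1.\<close>

lemma bounded_besselJ_of_real:
  assumes "0 < Re \<mu>"
  obtains B where "\<And>y. norm (besselJ \<mu> (of_real y)) \<le> B"
proof -
  obtain B1 where B1: "\<And>y. y \<ge> 1 \<Longrightarrow> norm (besselJ \<mu> (of_real y)) \<le> B1"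
    using bounded_besselJ_ge_1 by metis
  have "compact ((\<lambda>y. besselJ \<mu> (of_real y)) ` {-1..1})"
    by (intro compact_continuous_image continuous_on_besselJ_of_real assms) simp
  then obtain B2 where B2: "\<And>y. y \<in> {-1..1} \<Longrightarrow> norm (besselJ \<mu> (of_real y)) \<le> B2"
    unfolding bounded_iff by (meson compact_imp_bounded bounded_iff imageI)
  let ?e = "norm (exp (\<i> * pi * \<mu>))"
  have "norm (besselJ \<mu> (of_real y)) \<le> max B2 (max B1 (?e * B1))" for y
  proof -
    consider "y \<ge> 1" | "y \<in> {-1..1}" | "y \<le> -1" by fastforce
    then show ?thesis
    proof cases
      case 3
      then have "norm (besselJ \<mu> (of_real y)) = ?e * norm (besselJ \<mu> (of_real (- y)))"
        using besselJ_minus_of_real[of "- y" \<mu>] by (simp add: norm_mult)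
      also have "\<dots> \<le> ?e * B1"
        using 3 by (intro mult_left_mono B1) auto
      finally show ?thesis by linarith
    qed (use B1[of y] B2[of y] in linarith)+
  qed
  then show ?thesis using that by blast
qed

subsection \<open>Smooth functions on a compact interval\<close>

lemma dwithin_eqI:
  assumes "a < b" "x \<in> {a..b}" "(h has_vector_derivative d) (at x within {a..b})"
  shows "dwithin a b h x = d"
  using vector_derivative_within_cbox[of a b x h d] assms by (simp add: dwithin_def)

lemma nderiv_0 [simp]: "nderiv a b 0 h = h"
  by (simp add: nderiv_def)

lemma nderiv_Suc: "nderiv a b (Suc j) h = dwithin a b (nderiv a b j h)"
  by (simp add: nderiv_def)

lemma nderiv_Suc': "nderiv a b (Suc j) h = nderiv a b j (dwithin a b h)"
  by (simp add: nderiv_def funpow_swap1)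

text \<open>Derivatives within a nondegenerate interval are unique, so any chain \<open>D\<close> of
  successive derivatives must be the iterated ones. Smoothness is thus proved by exhibiting such a
  chain, and only values on [a, b] count.\<close>

lemma nderiv_unique:
  assumes "a < b"
    and "\<And>x. x \<in> {a..b} \<Longrightarrow> h x = D 0 x"
    and D: "\<And>j x. x \<in> {a..b} \<Longrightarrow> (D j has_vector_derivative D (Suc j) x) (at x within {a..b})"
  shows "x \<in> {a..b} \<Longrightarrow> nderiv a b j h x = D j x"
    and "smooth_on_interval a b h"
proof -
  have *: "\<forall>x\<in>{a..b}. nderiv a b j h x = D j x" for j
  proof (induction j)
    case (Suc j)
    then show ?case
      unfolding nderiv_Suc
      by (intro ballI dwithin_eqI[OF \<open>a < b\<close>])
        (auto intro: has_vector_derivative_transform[OF _ _ D])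
  qed (use assms in auto)
  show "x \<in> {a..b} \<Longrightarrow> nderiv a b j h x = D j x" using * by blast
  show "smooth_on_interval a b h"
    unfolding smooth_on_interval_def
  proof (intro allI ballI)
    fix j x assume x: "x \<in> {a..b}"
    show "(nderiv a b j h has_vector_derivative nderiv a b (Suc j) h x) (at x within {a..b})"
      using * x by (auto intro: has_vector_derivative_transform[OF _ _ D])
  qed
qed

lemma nderiv_cong:
  assumes "a < b" "smooth_on_interval a b h" "\<And>x. x \<in> {a..b} \<Longrightarrow> k x = h x"
  shows "x \<in> {a..b} \<Longrightarrow> nderiv a b j k x = nderiv a b j h x" and "smooth_on_interval a b k"
  using nderiv_unique[of a b k "\<lambda>j. nderiv a b j h"] assms
  by (auto simp: smooth_on_interval_def)

lemma smooth_on_interval_derivative: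
  assumes "smooth_on_interval a b h" "x \<in> {a..b}"
  shows "(h has_vector_derivative dwithin a b h x) (at x within {a..b})"
  using assms nderiv_Suc[of a b 0 h] unfolding smooth_on_interval_def by (metis nderiv_0)

lemma smooth_on_interval_nderiv:
  assumes "smooth_on_interval a b h"
  shows "smooth_on_interval a b (nderiv a b i h)"
proof -
  have "nderiv a b j (nderiv a b i h) = nderiv a b (j + i) h" for j
    by (simp add: nderiv_def funpow_add)
  then show ?thesis
    using assms unfolding smooth_on_interval_def by simp
qed

lemma smooth_on_interval_dwithin:
  "smooth_on_interval a b h \<Longrightarrow> smooth_on_interval a b (dwithin a b h)"
  using smooth_on_interval_nderiv[of a b h 1] by (simp add: nderiv_Suc)

lemma smooth_on_interval_continuous:
  assumes "smooth_on_interval a b h"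
  shows "continuous_on {a..b} h"
  unfolding continuous_on_eq_continuous_within
  by (intro ballI has_vector_derivative_continuous[OF smooth_on_interval_derivative[OF assms]])

lemma smooth_on_interval_of_real:
  assumes "a < b" "smooth_on_interval a b h"
  shows "x \<in> {a..b} \<Longrightarrow>
      nderiv a b j (\<lambda>x. of_real (h x) :: 'a::real_normed_algebra_1) x = of_real (nderiv a b j h x)"
    and "smooth_on_interval a b (\<lambda>x. of_real (h x) :: 'a)"
proof -
  have "((\<lambda>x. of_real (nderiv a b j h x) :: 'a) has_vector_derivative of_real (nderiv a b (Suc j) h x))
      (at x within {a..b})" if "x \<in> {a..b}" for j x
    using assms(2) that unfolding smooth_on_interval_def
    by (intro has_vector_derivative_of_real) (simp add: has_real_derivative_iff_has_vector_derivative)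
  note * = nderiv_unique[of a b "\<lambda>x. of_real (h x) :: 'a" "\<lambda>j x. of_real (nderiv a b j h x)", OF assms(1) _ this]
  show "x \<in> {a..b} \<Longrightarrow>
      nderiv a b j (\<lambda>x. of_real (h x) :: 'a::real_normed_algebra_1) x = of_real (nderiv a b j h x)"
    by (rule *(1)) auto
  show "smooth_on_interval a b (\<lambda>x. of_real (h x) :: 'a)"
    by (rule *(2)) auto
qed

section \<open>Closure of smooth functions under algebraic operations\<close>

primrec times_differentiable :: "real \<Rightarrow> real \<Rightarrow> nat \<Rightarrow> (real \<Rightarrow> 'a::real_normed_vector) \<Rightarrow> bool" where
  "times_differentiable a b 0 h \<longleftrightarrow> True"
| "times_differentiable a b (Suc n) h \<longleftrightarrow>
     (\<exists>h'. (\<forall>x\<in>{a..b}. (h has_vector_derivative h' x) (at x within {a..b})) \<and> times_differentiable a b n h')"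

lemma times_differentiable_Suc_D:
  "times_differentiable a b (Suc n) h \<Longrightarrow> times_differentiable a b n h"
proof (induction n arbitrary: h)
  case (Suc n)
  then show ?case by (metis times_differentiable.simps(2))
qed simp

lemma times_differentiable_cong:
  assumes "\<And>x. x \<in> {a..b} \<Longrightarrow> k x = h x" "times_differentiable a b n h"
  shows "times_differentiable a b n k"
proof (cases n)
  case (Suc m)
  then obtain h' where h': "\<And>x. x \<in> {a..b} \<Longrightarrow> (h has_vector_derivative h' x) (at x within {a..b})"
    "times_differentiable a b m h'"
    using assms(2) by (metis times_differentiable.simps(2))
  have "(k has_vector_derivative h' x) (at x within {a..b})" if "x \<in> {a..b}" for x
    using that assms(1) by (auto intro: has_vector_derivative_transform[OF _ _ h'(1)])
  then show ?thesis using h'(2) unfolding Suc times_differentiable.simps by blast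
qed simp

text \<open>Trades the explicit sequence \<open>nderiv\<close> for finite-order differentiability
  with an unnamed derivative. For the latter, sums, products and reciprocals follow by induction on
  the order, with no Leibniz formula for higher derivatives.\<close>

lemma smooth_on_interval_iff:
  assumes "a < b"
  shows "smooth_on_interval a b h \<longleftrightarrow> (\<forall>n. times_differentiable a b n h)"
proof
  assume h: "smooth_on_interval a b h"
  have "times_differentiable a b n (nderiv a b j h)" for n j
  proof (induction n arbitrary: j)
    case (Suc n)
    then show ?case using h unfolding smooth_on_interval_def by auto
  qed simp
  from this[of _ 0] show "\<forall>n. times_differentiable a b n h" by simp
next
  \<comment> \<open>The witness derivative may depend on the order n, but by uniqueness each one
    equals \<open>dwithin a b k\<close> on [a, b], so this single function is differentiable to
    every order.\<close>
  have step: "(\<forall>x\<in>{a..b}. (k has_vector_derivative dwithin a b k x) (at x within {a..b})) \<and>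
      (\<forall>n. times_differentiable a b n (dwithin a b k))"
    if k: "\<And>n. times_differentiable a b n k" for k :: "real \<Rightarrow> 'a"
  proof (intro conjI allI)
    have "\<exists>k'. (\<forall>x\<in>{a..b}. (k has_vector_derivative k' x) (at x within {a..b})) \<and>
        times_differentiable a b n k'" for n
      using k[of "Suc n"] by simp
    then obtain k' where k': "\<And>n x. x \<in> {a..b} \<Longrightarrow> (k has_vector_derivative k' n x) (at x within {a..b})"
      "\<And>n. times_differentiable a b n (k' n)"
      by metis
    have eq: "dwithin a b k x = k' n x" if "x \<in> {a..b}" for x n
      by (rule dwithin_eqI[OF assms that k'(1)[OF that]])
    show "\<forall>x\<in>{a..b}. (k has_vector_derivative dwithin a b k x) (at x within {a..b})"
      using k'(1) eq by simp
    show "times_differentiable a b n (dwithin a b k)" for n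
      by (rule times_differentiable_cong[OF eq k'(2)])
  qed
  assume h: "\<forall>n. times_differentiable a b n h"
  have "times_differentiable a b n (nderiv a b j h)" for n j
    by (induction j arbitrary: n) (use h step in \<open>auto simp: nderiv_Suc\<close>)
  then show "smooth_on_interval a b h"
    unfolding smooth_on_interval_def nderiv_Suc using step by blast
qed

lemma times_differentiable_const: "times_differentiable a b n (\<lambda>x. c)"
  by (induction n arbitrary: c) (auto intro!: exI[of _ "\<lambda>x. 0"])

lemma times_differentiable_add:
  "times_differentiable a b n f \<Longrightarrow> times_differentiable a b n g \<Longrightarrow>
    times_differentiable a b n (\<lambda>x. f x + g x)"
proof (induction n arbitrary: f g)
  case (Suc n)
  then obtain f' g' where
    "\<forall>x\<in>{a..b}. (f has_vector_derivative f' x) (at x within {a..b})" "times_differentiable a b n f'"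
    "\<forall>x\<in>{a..b}. (g has_vector_derivative g' x) (at x within {a..b})" "times_differentiable a b n g'"
    by auto
  then show ?case
    using Suc.IH[of f' g'] by (auto intro!: exI[of _ "\<lambda>x. f' x + g' x"] has_vector_derivative_add)
qed simp

lemma times_differentiable_mult:
  fixes f g :: "real \<Rightarrow> 'a::real_normed_algebra"
  shows "times_differentiable a b n f \<Longrightarrow> times_differentiable a b n g \<Longrightarrow>
    times_differentiable a b n (\<lambda>x. f x * g x)"
proof (induction n arbitrary: f g)
  case (Suc n)
  obtain f' g' where d:
    "\<forall>x\<in>{a..b}. (f has_vector_derivative f' x) (at x within {a..b})" "times_differentiable a b n f'"
    "\<forall>x\<in>{a..b}. (g has_vector_derivative g' x) (at x within {a..b})" "times_differentiable a b n g'"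
    using Suc.prems by auto
  have "times_differentiable a b n (\<lambda>x. f x * g' x + f' x * g x)"
    using d Suc.prems times_differentiable_Suc_D Suc.IH by (intro times_differentiable_add) blast+
  then show ?case
    using d by (auto intro!: exI[of _ "\<lambda>x. f x * g' x + f' x * g x"] has_vector_derivative_mult)
qed simp

lemma times_differentiable_inverse:
  fixes f :: "real \<Rightarrow> 'a::real_normed_field"
  assumes "\<And>x. x \<in> {a..b} \<Longrightarrow> f x \<noteq> 0"
  shows "times_differentiable a b n f \<Longrightarrow> times_differentiable a b n (\<lambda>x. inverse (f x))"
proof (induction n)
  case (Suc n)
  obtain f' where d:
    "\<forall>x\<in>{a..b}. (f has_vector_derivative f' x) (at x within {a..b})" "times_differentiable a b n f'"
    using Suc.prems by auto
  \<comment> \<open>The reciprocal reappears in its own derivative -f' / f^2, but there it is needed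
    only to the lower order n.\<close>
  have i: "times_differentiable a b n (\<lambda>x. inverse (f x))"
    using Suc times_differentiable_Suc_D by blast
  have "times_differentiable a b n (\<lambda>x. (- 1) * (f' x * (inverse (f x) * inverse (f x))))"
    by (intro times_differentiable_mult i d times_differentiable_const)
  moreover have "((\<lambda>x. inverse (f x)) has_vector_derivative
      (- 1) * (f' x * (inverse (f x) * inverse (f x)))) (at x within {a..b})" if "x \<in> {a..b}" for x
  proof -
    have "((inverse \<circ> f) has_vector_derivative f' x * - (inverse (f x) * inverse (f x))) (at x within {a..b})"
      using d(1) that DERIV_inverse'[OF DERIV_ident assms[OF that]]
      by (intro field_vector_diff_chain_within) (auto intro: DERIV_subset[of _ _ _ UNIV])
    then show ?thesis by (simp add: o_def)
  qed
  ultimately show ?case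
    unfolding times_differentiable.simps
    by (intro exI[of _ "\<lambda>x. (- 1) * (f' x * (inverse (f x) * inverse (f x)))"] conjI ballI)
qed simp

lemma smooth_on_interval_const: "a < b \<Longrightarrow> smooth_on_interval a b (\<lambda>x. c)"
  by (simp add: smooth_on_interval_iff times_differentiable_const)

lemma smooth_on_interval_add:
  "a < b \<Longrightarrow> smooth_on_interval a b f \<Longrightarrow> smooth_on_interval a b g \<Longrightarrow>
    smooth_on_interval a b (\<lambda>x. f x + g x)"
  by (simp add: smooth_on_interval_iff times_differentiable_add)

lemma smooth_on_interval_mult:
  fixes f g :: "real \<Rightarrow> 'a::real_normed_algebra"
  shows "a < b \<Longrightarrow> smooth_on_interval a b f \<Longrightarrow> smooth_on_interval a b g \<Longrightarrow>
    smooth_on_interval a b (\<lambda>x. f x * g x)"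
  by (simp add: smooth_on_interval_iff times_differentiable_mult)

lemma smooth_on_interval_divide:
  fixes f g :: "real \<Rightarrow> 'a::real_normed_field"
  shows "a < b \<Longrightarrow> smooth_on_interval a b f \<Longrightarrow> smooth_on_interval a b g \<Longrightarrow>
    (\<And>x. x \<in> {a..b} \<Longrightarrow> g x \<noteq> 0) \<Longrightarrow> smooth_on_interval a b (\<lambda>x. f x / g x)"
  unfolding divide_inverse smooth_on_interval_iff
  by (intro allI times_differentiable_mult times_differentiable_inverse) auto

lemma smooth_on_interval_diff_const: "a < b \<Longrightarrow> smooth_on_interval a b (\<lambda>x. x - c)"
  unfolding smooth_on_interval_iff
proof
  fix n
  show "times_differentiable a b n (\<lambda>x. x - c)"
    by (cases n) (auto intro!: exI[of _ "\<lambda>x. 1"] times_differentiable_const derivative_eq_intros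
        simp: has_real_derivative_iff_has_vector_derivative[symmetric])
qed

text \<open>Hadamard's lemma; the quotient is \<open>\<integral>\<^sub>0\<^sup>1 s' (a + t (x - a)) dt\<close>, differentiated under the integral.\<close>
lemma smooth_on_interval_Hadamard:
  fixes s :: "real \<Rightarrow> 'a::banach"
  assumes "a < b" and s: "smooth_on_interval a b s"
  obtains \<psi> where "smooth_on_interval a b \<psi>"
    and "\<And>x. x \<in> {a..b} \<Longrightarrow> s x = s a + (x - a) *\<^sub>R \<psi> x"
    and "\<And>j. nderiv a b j \<psi> a = nderiv a b (Suc j) s a /\<^sub>R real (Suc j)"
proof -
  \<comment> \<open>The candidate j-th derivative of the quotient: each differentiation in x brings
    down one more factor t.\<close>
  define D where "D = (\<lambda>j x. integral (cbox 0 1) (\<lambda>t. t ^ j *\<^sub>R nderiv a b (Suc j) s (a + t * (x - a))))"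
  have mem: "a + t * (x - a) \<in> {a..b}" if "x \<in> {a..b}" "t \<in> {0..1}" for x t
  proof -
    have "t * (x - a) \<le> 1 * (x - a)" using that by (intro mult_right_mono) auto
    then show ?thesis using that by auto
  qed
  have contn: "continuous_on {a..b} (nderiv a b j s)" for j
    by (intro smooth_on_interval_continuous smooth_on_interval_nderiv s)
  have d: "(nderiv a b j s has_vector_derivative nderiv a b (Suc j) s x) (at x within {a..b})"
    if "x \<in> {a..b}" for j x
    using that s by (simp add: smooth_on_interval_def)
  have D: "(D j has_vector_derivative D (Suc j) x) (at x within {a..b})" if x: "x \<in> {a..b}" for j x
    unfolding D_def
  proof (rule leibniz_rule_vector_derivative)
    fix y t :: real assume yt: "y \<in> {a..b}" "t \<in> cbox 0 1"
    have "(nderiv a b (Suc j) s \<circ> (\<lambda>x. a + t * (x - a)) has_vector_derivative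
        t *\<^sub>R nderiv a b (Suc (Suc j)) s (a + t * (y - a))) (at y within {a..b})"
    proof (rule vector_diff_chain_within)
      show "((\<lambda>x. a + t * (x - a)) has_vector_derivative t) (at y within {a..b})"
        by (auto intro!: derivative_eq_intros simp: has_real_derivative_iff_has_vector_derivative[symmetric])
      show "(nderiv a b (Suc j) s has_vector_derivative nderiv a b (Suc (Suc j)) s (a + t * (y - a)))
          (at (a + t * (y - a)) within (\<lambda>x. a + t * (x - a)) ` {a..b})"
        by (rule has_vector_derivative_within_subset[OF d]) (use mem yt in auto)
    qed
    from has_vector_derivative_scaleR[OF DERIV_const this, of "t ^ j"]
    show "((\<lambda>x. t ^ j *\<^sub>R nderiv a b (Suc j) s (a + t * (x - a))) has_vector_derivative
        t ^ Suc j *\<^sub>R nderiv a b (Suc (Suc j)) s (a + t * (y - a))) (at y within {a..b})"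
      by (simp add: o_def mult.commute)
  next
    fix y assume "y \<in> {a..b}"
    then show "(\<lambda>t. t ^ j *\<^sub>R nderiv a b (Suc j) s (a + t * (y - a))) integrable_on cbox 0 1"
      by (intro integrable_continuous continuous_intros continuous_on_compose2[OF contn])
        (use mem in auto)
  next
    show "continuous_on ({a..b} \<times> cbox 0 1)
        (\<lambda>(x, t). t ^ Suc j *\<^sub>R nderiv a b (Suc (Suc j)) s (a + t * (x - a)))"
      unfolding split_beta
      by (intro continuous_intros continuous_on_compose2[OF contn]) (use mem in auto)
  qed (use x in auto)
  show ?thesis
  proof (rule that[of "D 0"])
    show "smooth_on_interval a b (D 0)"
      by (rule nderiv_unique(2)[where D = D, OF \<open>a < b\<close> refl D])
    show "s x = s a + (x - a) *\<^sub>R D 0 x" if x: "x \<in> {a..b}" for x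
    proof -
      have "((\<lambda>t. (x - a) *\<^sub>R nderiv a b (Suc 0) s (a + t * (x - a))) has_integral
          (s \<circ> (\<lambda>t. a + t * (x - a))) 1 - (s \<circ> (\<lambda>t. a + t * (x - a))) 0) {0..1}"
      proof (rule fundamental_theorem_of_calculus)
        fix t :: real assume t: "t \<in> {0..1}"
        show "(s \<circ> (\<lambda>t. a + t * (x - a)) has_vector_derivative
            (x - a) *\<^sub>R nderiv a b (Suc 0) s (a + t * (x - a))) (at t within {0..1})"
        proof (rule vector_diff_chain_within)
          show "((\<lambda>t. a + t * (x - a)) has_vector_derivative x - a) (at t within {0..1})"
            by (auto intro!: derivative_eq_intros simp: has_real_derivative_iff_has_vector_derivative[symmetric])
          show "(s has_vector_derivative nderiv a b (Suc 0) s (a + t * (x - a)))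
              (at (a + t * (x - a)) within (\<lambda>t. a + t * (x - a)) ` {0..1})"
            by (rule has_vector_derivative_within_subset[OF d[of _ 0, simplified]]) (use mem t x in auto)
        qed
      qed simp
      then have "integral {0..1} (\<lambda>t. (x - a) *\<^sub>R nderiv a b (Suc 0) s (a + t * (x - a))) = s x - s a"
        by (intro integral_unique) simp
      then show ?thesis by (simp add: D_def)
    qed
    show "nderiv a b j (D 0) a = nderiv a b (Suc j) s a /\<^sub>R real (Suc j)" for j
    proof -
      have "nderiv a b j (D 0) a = D j a"
        by (rule nderiv_unique(1)[where D = D, OF \<open>a < b\<close> refl D]) (use \<open>a < b\<close> in auto)
      \<comment> \<open>At x = a the argument of the derivative of s is constantly a, so the
        integral of t^j is all that remains and yields 1 / (j + 1).\<close>
      also have "((\<lambda>t. t ^ j) has_integral 1 / real (Suc j)) {0..1::real}"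
      proof -
        have "((\<lambda>t. t ^ Suc j / real (Suc j)) has_vector_derivative t ^ j) (at t within {0..1})" for t :: real
          unfolding has_real_derivative_iff_has_vector_derivative[symmetric]
          by (rule derivative_eq_intros refl)+ (simp_all add: field_simps del: of_nat_Suc)
        from fundamental_theorem_of_calculus[OF zero_le_one this] show ?thesis
          by simp
      qed
      from has_integral_scaleR_left[OF this, where c = "nderiv a b (Suc j) s a"]
      have "D j a = nderiv a b (Suc j) s a /\<^sub>R real (Suc j)"
        unfolding D_def by (intro integral_unique) (simp add: inverse_eq_divide)
      finally show ?thesis .
    qed
  qed
qed

text \<open>Hadamard's lemma applied n times. The cofactor \<open>h\<close> is smooth up to the
  endpoint a, which a mere remainder estimate would not give, and its value at a later decides
  whether the phase factors vanish there.\<close>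

lemma smooth_on_interval_Taylor:
  fixes s :: "real \<Rightarrow> complex"
  assumes "a < b" and "smooth_on_interval a b s"
  obtains h where "smooth_on_interval a b h"
    and "\<And>x. x \<in> {a..b} \<Longrightarrow>
      s x = (\<Sum>j<n. nderiv a b j s a / fact j * of_real ((x - a) ^ j)) + of_real ((x - a) ^ n) * h x"
    and "h a = nderiv a b n s a / fact n"
proof -
  have "\<exists>h. smooth_on_interval a b h \<and> (\<forall>x\<in>{a..b}.
      s x = (\<Sum>j<n. nderiv a b j s a / fact j * of_real ((x - a) ^ j)) + of_real ((x - a) ^ n) * h x) \<and>
      h a = nderiv a b n s a / fact n"
    using assms(2)
  proof (induction n arbitrary: s)
    case 0
    then show ?case by auto
  next
    case (Suc n)
    obtain \<psi> where \<psi>: "smooth_on_interval a b \<psi>"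
      "\<And>x. x \<in> {a..b} \<Longrightarrow> s x = s a + (x - a) *\<^sub>R \<psi> x"
      "\<And>j. nderiv a b j \<psi> a = nderiv a b (Suc j) s a /\<^sub>R real (Suc j)"
      using smooth_on_interval_Hadamard[OF assms(1) Suc.prems] by blast
    have c: "nderiv a b j \<psi> a / fact j = nderiv a b (Suc j) s a / fact (Suc j)" for j
      by (simp add: \<psi>(3) scaleR_conv_of_real field_simps)
    \<comment> \<open>The factor 1 / (j + 1) from Hadamard's lemma has turned j! into (j + 1)!, so
      these are already the coefficients of s, shifted by one.\<close>
    obtain h where h: "smooth_on_interval a b h"
      "\<And>x. x \<in> {a..b} \<Longrightarrow> \<psi> x = (\<Sum>j<n. nderiv a b (Suc j) s a / fact (Suc j) * of_real ((x - a) ^ j))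
        + of_real ((x - a) ^ n) * h x"
      "h a = nderiv a b (Suc n) s a / fact (Suc n)"
      using Suc.IH[OF \<psi>(1)] unfolding c by blast
    have "s x = (\<Sum>j<Suc n. nderiv a b j s a / fact j * of_real ((x - a) ^ j)) + of_real ((x - a) ^ Suc n) * h x"
      if "x \<in> {a..b}" for x
      using \<psi>(2)[OF that] h(2)[OF that] unfolding sum.lessThan_Suc_shift
      by (simp add: scaleR_conv_of_real distrib_left sum_distrib_left mult_ac del: fact_Suc of_real_diff)
    then show ?case using h by blast
  qed
  then show ?thesis using that by blast
qed

subsection \<open>Asymptotic expansion of the Hankel transform\<close>

lemma powr_integrable_on:
  fixes a b \<alpha> :: real
  assumes "a \<le> b" "\<alpha> > -1"
  shows "(\<lambda>x. (x - a) powr \<alpha>) integrable_on {a..b}"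
proof -
  have "((\<lambda>x. (x - a) powr \<alpha>) has_integral
      (b - a) powr (\<alpha> + 1) / (\<alpha> + 1) - (a - a) powr (\<alpha> + 1) / (\<alpha> + 1)) {a..b}"
  proof (rule fundamental_theorem_of_calculus_interior)
    show "continuous_on {a..b} (\<lambda>x. (x - a) powr (\<alpha> + 1) / (\<alpha> + 1))"
      using assms by (intro continuous_intros continuous_on_powr') auto
    show "((\<lambda>x. (x - a) powr (\<alpha> + 1) / (\<alpha> + 1)) has_vector_derivative (x - a) powr \<alpha>) (at x)"
      if "x \<in> {a<..<b}" for x
      using that assms unfolding has_real_derivative_iff_has_vector_derivative[symmetric]
      by (auto intro!: derivative_eq_intros)
  qed (use assms in auto)
  then show ?thesis by blast
qed

text \<open>Normal form of a phase with a zero of exact order r + 1 at a: the zero-free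
  \<open>p\<close> and \<open>q\<close> carry what is left of g and g'. They are complex-valued so
  that the complex functions sigma_k can be divided by them directly.\<close>

locale hankel_phase =
  fixes a b :: real and r :: nat and g :: "real \<Rightarrow> real" and p q :: "real \<Rightarrow> complex"
  assumes less: "a < b"
    and smooth_g: "smooth_on_interval a b g"
    and smooth_p: "smooth_on_interval a b p"
    and smooth_q: "smooth_on_interval a b q"
    and g_eq: "x \<in> {a..b} \<Longrightarrow> complex_of_real (g x) = of_real ((x - a) ^ Suc r) * p x"
    and dg_eq: "x \<in> {a..b} \<Longrightarrow> complex_of_real (dwithin a b g x) = of_real ((x - a) ^ r) * q x"
    and p_nonzero: "x \<in> {a..b} \<Longrightarrow> p x \<noteq> 0"
    and q_nonzero: "x \<in> {a..b} \<Longrightarrow> q x \<noteq> 0"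
begin

lemma g_a [simp]: "g a = 0"
  using g_eq[of a] less by simp

lemma g_nonzero: "x \<in> {a<..b} \<Longrightarrow> g x \<noteq> 0"
  using g_eq[of x] p_nonzero[of x] by auto

lemma dg_nonzero: "x \<in> {a<..b} \<Longrightarrow> dwithin a b g x \<noteq> 0"
  using dg_eq[of x] q_nonzero[of x] by auto

text \<open>With \<open>s - T\<^sub>r[s] = (x - a) ^ Suc r * h\<close> one takes \<open>w = (x - a) * h / q\<close>; the singular factor
  \<open>w * g' / g\<close> is then the smooth function \<open>h / p\<close>.\<close>
lemma sigma_step:
  assumes s: "smooth_on_interval a b s"
  obtains w v where "smooth_on_interval a b w" "smooth_on_interval a b v" "w a = 0"
    "\<And>x. x \<in> {a..b} \<Longrightarrow> s x - taylor_poly a b r s x a = w x * of_real (dwithin a b g x)"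
    "\<And>x. x \<in> {a<..b} \<Longrightarrow> v x = dwithin a b w x - \<mu> * (w x * of_real (dwithin a b g x) / of_real (g x))"
proof -
  obtain h where h: "smooth_on_interval a b h"
    "\<And>x. x \<in> {a..b} \<Longrightarrow> s x = (\<Sum>j<Suc r. nderiv a b j s a / fact j * of_real ((x - a) ^ j))
        + of_real ((x - a) ^ Suc r) * h x"
    "h a = nderiv a b (Suc r) s a / fact (Suc r)"
    by (rule smooth_on_interval_Taylor[OF less s, where n = "Suc r"]) (rule that)
  define w where "w = (\<lambda>x. of_real (x - a) * (h x / q x))"
  define v where "v = (\<lambda>x. dwithin a b w x + (- \<mu>) * (h x / p x))"
  have w: "smooth_on_interval a b w"
    unfolding w_def
    by (intro smooth_on_interval_mult smooth_on_interval_divide smooth_on_interval_of_real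
        smooth_on_interval_diff_const less h(1) smooth_q q_nonzero)
  moreover have "smooth_on_interval a b v"
    unfolding v_def
    by (intro smooth_on_interval_add smooth_on_interval_mult smooth_on_interval_divide
        smooth_on_interval_dwithin smooth_on_interval_const less h(1) w smooth_p p_nonzero)
  moreover have "w a = 0" by (simp add: w_def)
  moreover have eq: "s x - taylor_poly a b r s x a = w x * of_real (dwithin a b g x)" if "x \<in> {a..b}" for x
    using h(2)[OF that] q_nonzero[OF that] unfolding dg_eq[OF that]
    by (simp add: taylor_poly_def lessThan_Suc_atMost w_def)
  moreover have "v x = dwithin a b w x - \<mu> * (w x * of_real (dwithin a b g x) / of_real (g x))"
    if "x \<in> {a<..b}" for x
  proof -
    have x: "x \<in> {a..b}" and nz: "of_real (x - a) \<noteq> (0::complex)" using that by auto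
    have "w x * of_real (dwithin a b g x) / of_real (g x) = h x / p x"
      unfolding dg_eq[OF x] g_eq[OF x] w_def
      using nz q_nonzero[OF x] p_nonzero[OF x] by (simp add: divide_simps del: of_real_diff)
    then show ?thesis by (simp add: v_def)
  qed
  ultimately show ?thesis by (rule that)
qed

text \<open>The bracket in the definition of sigma is w g^(-mu), and the product rule gives g^mu (w
  g^(-mu))' = w' - mu w g' / g, which is v off a. As v is continuous, the limit at a is
  v(a).\<close>

lemma sigma_hat_Suc_eq:
  fixes k f \<nu>
  defines "s \<equiv> sigma_hat a b r \<nu> g f k" and "\<mu> \<equiv> \<nu> + of_nat (Suc k)"
  assumes w: "smooth_on_interval a b w" and v: "smooth_on_interval a b v" and w_a: "w a = 0"
    and sT: "\<And>x. x \<in> {a..b} \<Longrightarrow> s x - taylor_poly a b r s x a = w x * of_real (dwithin a b g x)"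
    and v_eq: "\<And>x. x \<in> {a<..b} \<Longrightarrow>
      v x = dwithin a b w x - \<mu> * (w x * of_real (dwithin a b g x) / of_real (g x))"
    and x: "x \<in> {a..b}"
  shows "sigma_hat a b r \<nu> g f (Suc k) x = v x"
proof -
  define Q where "Q = (\<lambda>x. (s x - taylor_poly a b r s x a) /
      (complex_of_real (g x) powr \<mu> * complex_of_real (dwithin a b g x)))"
  define e where "e = (\<lambda>x. complex_of_real (g x) powr \<mu> * dwithin a b Q x)"
  have sigma: "sigma_hat a b r \<nu> g f (Suc k) = (\<lambda>x. if x = a then Lim (at_right a) e else e x)"
    unfolding sigma_hat.simps(2) Let_def e_def Q_def s_def \<mu>_def by (rule refl)
  have Q: "Q x = w x * of_real (g x) powr (- \<mu>)" if "x \<in> {a..b}" for x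
  proof (cases "x = a")
    case True
    \<comment> \<open>At a both sides are 0: on the left the denominator is 0 and division by 0
      gives 0, on the right w(a) = 0.\<close>
    then show ?thesis by (simp add: Q_def w_a)
  next
    case False
    then have nz: "complex_of_real (dwithin a b g x) \<noteq> 0" using dg_nonzero[of x] that by auto
    have "Q x = w x / complex_of_real (g x) powr \<mu>"
      unfolding Q_def sT[OF that] by (rule nonzero_mult_divide_mult_cancel_right[OF nz])
    then show ?thesis by (simp add: powr_minus divide_inverse)
  qed
  have e: "e x = v x" if x: "x \<in> {a<..b}" for x
  proof -
    have xI: "x \<in> {a..b}" and gx: "g x \<noteq> 0" using x g_nonzero by auto
    have "((\<lambda>y. complex_of_real y powr (- \<mu>)) \<circ> g has_vector_derivative
        dwithin a b g x *\<^sub>R (- \<mu> * of_real (g x) powr (- \<mu> - 1))) (at x within {a..b})"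
      by (rule vector_diff_chain_within[OF smooth_on_interval_derivative[OF smooth_g xI]
          has_vector_derivative_at_within[OF has_vector_derivative_of_real_powr[OF gx]]])
    from has_vector_derivative_mult[OF smooth_on_interval_derivative[OF w xI] this]
    have "((\<lambda>x. w x * of_real (g x) powr (- \<mu>)) has_vector_derivative
        w x * (dwithin a b g x *\<^sub>R (- \<mu> * of_real (g x) powr (- \<mu> - 1)))
        + dwithin a b w x * of_real (g x) powr (- \<mu>)) (at x within {a..b})"
      by (simp add: o_def)
    from has_vector_derivative_transform[OF xI Q this]
    have "dwithin a b Q x = w x * (dwithin a b g x *\<^sub>R (- \<mu> * of_real (g x) powr (- \<mu> - 1)))
        + dwithin a b w x * of_real (g x) powr (- \<mu>)"
      by (intro dwithin_eqI less xI)
    moreover have "complex_of_real (g x) powr (- \<mu> - 1) = of_real (g x) powr (- \<mu>) / of_real (g x)"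
      using gx by (simp add: powr_diff)
    ultimately have "dwithin a b Q x = v x * of_real (g x) powr (- \<mu>)"
      unfolding v_eq[OF x] using gx by (simp add: scaleR_conv_of_real field_simps)
    then show ?thesis
      using gx by (simp add: e_def powr_minus)
  qed
  have "((v \<longlongrightarrow> v a) (at_right a))"
    using smooth_on_interval_continuous[OF v] less
    by (metis atLeastAtMost_iff at_within_Icc_at_right continuous_on_def less_eq_real_def)
  moreover have "eventually (\<lambda>x. v x = e x) (at_right a)"
    using e less by (intro eventually_at_rightI[of a b]) auto
  ultimately have "(e \<longlongrightarrow> v a) (at_right a)"
    by (rule Lim_transform_eventually)
  then have "Lim (at_right a) e = v a"
    by (intro tendsto_Lim) auto
  then show ?thesis
    using e[of x] x unfolding sigma by auto
qed

text \<open>By induction: \<open>sigma_step\<close> supplies a smooth v, and the next sigma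
  coincides with it on [a, b].\<close>

lemma smooth_sigma_hat:
  assumes f: "smooth_on_interval a b f"
  shows "smooth_on_interval a b (sigma_hat a b r \<nu> g f k)"
proof (induction k)
  case 0
  then show ?case using smooth_on_interval_of_real(2)[OF less f] by simp
next
  case (Suc k)
  show ?case
    by (rule sigma_step[OF Suc, of "\<nu> + of_nat (Suc k)"])
      (rule nderiv_cong(2)[OF less], assumption, rule sigma_hat_Suc_eq)
qed

section \<open>Integration by parts, integrability and moments\<close>

lemma has_integral_by_parts:
  assumes w: "smooth_on_interval a b w" and v: "smooth_on_interval a b v" and w_a: "w a = 0"
    and v_eq: "\<And>x. x \<in> {a<..b} \<Longrightarrow>
      v x = dwithin a b w x - (\<mu> + 1) * (w x * of_real (dwithin a b g x) / of_real (g x))"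
    and \<omega>: "\<omega> > 0" and \<mu>: "Re \<mu> + 1 > 0"
  shows "((\<lambda>x. w x * of_real (dwithin a b g x) * besselJ \<mu> (of_real (\<omega> * g x))) has_integral
      1 / of_real \<omega> * (w b * besselJ (\<mu> + 1) (of_real (\<omega> * g b))
        - integral {a..b} (\<lambda>x. v x * besselJ (\<mu> + 1) (of_real (\<omega> * g x))))) {a..b}"
proof -
  define J where "J = (\<lambda>\<mu> x. besselJ \<mu> (complex_of_real (\<omega> * g x)))"
  have contJ: "continuous_on {a..b} (J (\<mu> + 1))"
    unfolding J_def
    by (rule continuous_on_compose2[OF continuous_on_besselJ_of_real[of "\<mu> + 1" UNIV]])
      (use \<mu> in \<open>auto intro!: continuous_on_mult continuous_on_const
        smooth_on_interval_continuous[OF smooth_g]\<close>)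
  \<comment> \<open>The derivative of J_(mu+1)(omega g) is omega g' J_mu minus a term singular like
    g' / g; that term and w' together make up v.\<close>
  have d: "((\<lambda>x. w x * J (\<mu> + 1) x) has_vector_derivative
      of_real \<omega> * (w x * of_real (dwithin a b g x) * J \<mu> x) + v x * J (\<mu> + 1) x) (at x)"
    if x: "x \<in> {a<..<b}" for x
  proof -
    have at: "at x within {a..b} = at x" and xI: "x \<in> {a..b}" and gx: "g x \<noteq> 0"
      using x g_nonzero by (auto simp: at_within_Icc_at)
    have dg: "(g has_real_derivative dwithin a b g x) (at x)"
      using smooth_on_interval_derivative[OF smooth_g xI]
      by (simp add: at has_real_derivative_iff_has_vector_derivative)
    have "((\<lambda>x. \<omega> * g x) has_vector_derivative \<omega> * dwithin a b g x) (at x)"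
      unfolding has_real_derivative_iff_has_vector_derivative[symmetric] by (rule DERIV_cmult[OF dg])
    moreover have "((\<lambda>y. besselJ (\<mu> + 1) (of_real y)) has_vector_derivative
        J \<mu> x - (\<mu> + 1) / of_real (\<omega> * g x) * J (\<mu> + 1) x) (at (\<omega> * g x))"
      using besselJ_of_real_derivatives(2)[of "\<omega> * g x" "\<mu> + 1"] gx \<omega> by (simp add: J_def)
    ultimately have "(((\<lambda>y. besselJ (\<mu> + 1) (of_real y)) \<circ> (\<lambda>x. \<omega> * g x)) has_vector_derivative
        (\<omega> * dwithin a b g x) *\<^sub>R (J \<mu> x - (\<mu> + 1) / of_real (\<omega> * g x) * J (\<mu> + 1) x)) (at x)"
      by (rule vector_diff_chain_at)
    then have dJ: "(J (\<mu> + 1) has_vector_derivative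
        (\<omega> * dwithin a b g x) *\<^sub>R (J \<mu> x - (\<mu> + 1) / of_real (\<omega> * g x) * J (\<mu> + 1) x)) (at x)"
      by (simp add: o_def J_def)
    have dw: "(w has_vector_derivative dwithin a b w x) (at x)"
      using smooth_on_interval_derivative[OF w xI] by (simp add: at)
    have vx: "v x = dwithin a b w x - (\<mu> + 1) * (w x * of_real (dwithin a b g x) / of_real (g x))"
      using v_eq x by auto
    have "w x * ((\<omega> * dwithin a b g x) *\<^sub>R (J \<mu> x - (\<mu> + 1) / of_real (\<omega> * g x) * J (\<mu> + 1) x))
        + dwithin a b w x * J (\<mu> + 1) x
        = of_real \<omega> * (w x * of_real (dwithin a b g x) * J \<mu> x) + v x * J (\<mu> + 1) x"
      unfolding vx using gx \<omega> by (simp add: scaleR_conv_of_real field_simps)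
    with has_vector_derivative_mult[OF dw dJ] show ?thesis by simp
  qed
  \<comment> \<open>The derivative formula is available only in the interior, since g(a) = 0.
    Continuity at a suffices here, and it holds because Re mu + 1 > 0.\<close>
  have "((\<lambda>x. of_real \<omega> * (w x * of_real (dwithin a b g x) * J \<mu> x) + v x * J (\<mu> + 1) x) has_integral
      w b * J (\<mu> + 1) b - w a * J (\<mu> + 1) a) {a..b}"
    by (rule fundamental_theorem_of_calculus_interior[OF less_imp_le[OF less] _ d])
      (intro continuous_intros contJ smooth_on_interval_continuous w)
  moreover have "((\<lambda>x. v x * J (\<mu> + 1) x) has_integral integral {a..b} (\<lambda>x. v x * J (\<mu> + 1) x)) {a..b}"
    by (intro integrable_integral integrable_continuous_real continuous_intros contJ
        smooth_on_interval_continuous v)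
  ultimately have "((\<lambda>x. (of_real \<omega> * (w x * of_real (dwithin a b g x) * J \<mu> x) + v x * J (\<mu> + 1) x)
      - v x * J (\<mu> + 1) x) has_integral
      w b * J (\<mu> + 1) b - w a * J (\<mu> + 1) a - integral {a..b} (\<lambda>x. v x * J (\<mu> + 1) x)) {a..b}"
    by (rule has_integral_diff)
  from has_integral_mult_right[OF this, of "1 / of_real \<omega>"] show ?thesis
    using \<omega> by (simp add: J_def w_a)
qed

text \<open>Re mu may be negative, making the integrand unbounded at a. It is dominated by a
  multiple of |g|^(Re mu), hence of (x - a)^((r+1) Re mu), whose exponent exceeds -1.\<close>

lemma besselJ_integrable_on:
  assumes \<mu>: "real (Suc r) * Re \<mu> > -1" and \<omega>: "\<omega> > 0" and \<phi>: "continuous_on {a..b} \<phi>"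
  shows "(\<lambda>x. \<phi> x * besselJ \<mu> (of_real (\<omega> * g x))) integrable_on {a..b}"
proof -
  have contg: "continuous_on {a..b} g" by (intro smooth_on_interval_continuous smooth_g)
  have contJ: "continuous_on {a<..b} (\<lambda>x. besselJ \<mu> (of_real (\<omega> * g x)))"
  proof (rule continuous_on_compose2[where t = "-{0}" and g = "\<lambda>y. besselJ \<mu> (complex_of_real y)"])
    show "continuous_on (- {0}) (\<lambda>y. besselJ \<mu> (complex_of_real y))"
    proof (intro continuous_at_imp_continuous_on ballI)
      fix y :: real assume "y \<in> - {0}"
      then show "isCont (\<lambda>y. besselJ \<mu> (complex_of_real y)) y"
        by (intro has_vector_derivative_continuous[OF besselJ_of_real_derivatives(1)]) auto
    qed
    show "continuous_on {a<..b} (\<lambda>x. \<omega> * g x)"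
      by (intro continuous_intros continuous_on_subset[OF contg]) auto
    show "(\<lambda>x. \<omega> * g x) ` {a<..b} \<subseteq> - {0}" using g_nonzero \<omega> by auto
  qed
  obtain Y where Y: "\<And>x. x \<in> {a..b} \<Longrightarrow> \<bar>\<omega> * g x\<bar> \<le> Y"
  proof -
    have "compact ((\<lambda>x. \<omega> * g x) ` {a..b})"
      by (intro compact_continuous_image continuous_intros contg) auto
    then show ?thesis using that by (metis compact_imp_bounded bounded_iff imageI real_norm_def)
  qed
  obtain C where C: "C \<ge> 0"
    "\<And>y. \<bar>y\<bar> \<le> Y \<Longrightarrow> y \<noteq> 0 \<Longrightarrow> norm (besselJ \<mu> (of_real y)) \<le> C * \<bar>y\<bar> powr Re \<mu>"
    using besselJ_of_real_le by blast
  \<comment> \<open>Collects the factors that are continuous on all of [a, b]; |p|^(Re mu) is among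
    them since p has no zero.\<close>
  let ?\<psi> = "\<lambda>x. norm (\<phi> x) * (C * (\<omega> powr Re \<mu> * norm (p x) powr Re \<mu>))"
  have "compact (?\<psi> ` {a..b})"
    by (intro compact_continuous_image continuous_intros \<phi> smooth_on_interval_continuous smooth_p)
      (use p_nonzero in auto)
  then obtain K where K: "\<And>x. x \<in> {a..b} \<Longrightarrow> norm (?\<psi> x) \<le> K"
    by (metis (no_types, lifting) compact_imp_bounded bounded_iff imageI)
  let ?F = "\<lambda>x. \<phi> x * besselJ \<mu> (of_real (\<omega> * g x))"
  let ?\<alpha> = "real (Suc r) * Re \<mu>"
  have bound: "norm (?F x) \<le> K * (x - a) powr ?\<alpha>" if x: "x \<in> {a<..b}" for x
  proof -
    have xI: "x \<in> {a..b}" using x by auto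
    have "\<bar>g x\<bar> = (x - a) ^ Suc r * norm (p x)"
      using arg_cong[OF g_eq[OF xI], of norm] x by (simp add: norm_mult norm_power del: of_real_power of_real_diff)
    then have "\<bar>\<omega> * g x\<bar> powr Re \<mu> = \<omega> powr Re \<mu> * (((x - a) ^ Suc r) powr Re \<mu> * norm (p x) powr Re \<mu>)"
      using \<omega> x by (simp add: abs_mult powr_mult del: power_Suc)
    also have "((x - a) ^ Suc r) powr Re \<mu> = (x - a) powr ?\<alpha>"
      using x by (simp add: powr_powr flip: powr_realpow del: power_Suc of_nat_Suc)
    finally have "\<bar>\<omega> * g x\<bar> powr Re \<mu> = \<omega> powr Re \<mu> * norm (p x) powr Re \<mu> * (x - a) powr ?\<alpha>"
      by simp
    then have "norm (besselJ \<mu> (of_real (\<omega> * g x)))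
        \<le> C * (\<omega> powr Re \<mu> * norm (p x) powr Re \<mu> * (x - a) powr ?\<alpha>)"
      using C(2)[OF Y[OF xI]] g_nonzero[OF x] \<omega> by simp
    then have "norm (?F x) \<le> norm (\<phi> x) * (C * (\<omega> powr Re \<mu> * norm (p x) powr Re \<mu> * (x - a) powr ?\<alpha>))"
      unfolding norm_mult by (intro mult_left_mono) auto
    also have "\<dots> = ?\<psi> x * (x - a) powr ?\<alpha>" by (simp add: mult_ac)
    also have "\<dots> \<le> K * (x - a) powr ?\<alpha>"
      using K[OF xI] by (intro mult_right_mono) auto
    finally show ?thesis .
  qed
  have "(\<lambda>x. K * (x - a) powr ?\<alpha>) integrable_on {a..b}"
    using powr_integrable_on[OF less_imp_le[OF less] \<mu>] by (rule integrable_on_mult_right)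
  \<comment> \<open>Continuity and the bound hold only off a, so the comparison is made on the
    half-open interval; the point a is negligible.\<close>
  then have "(\<lambda>x. K * (x - a) powr ?\<alpha>) integrable_on {a<..b}"
    by (rule integrable_spike_set) (auto intro: negligible_subset[of "{a}"])
  then have "?F absolutely_integrable_on {a<..b}"
    by (intro measurable_bounded_by_integrable_imp_absolutely_integrable[OF _ _ _ bound]
        continuous_imp_measurable_on_sets_lebesgue continuous_on_mult contJ
        continuous_on_subset[OF \<phi>]) auto
  then have "?F integrable_on {a<..b}"
    by (rule set_lebesgue_integral_eq_integral(1))
  then show ?thesis
    by (rule integrable_spike_set) (auto intro: negligible_subset[of "{a}"])
qed

lemma Taylor_moments:
  assumes "smooth_on_interval a b s" and \<mu>: "real (Suc r) * Re \<mu> > -1" and \<omega>: "\<omega> > 0"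
  shows "integral {a..b} (\<lambda>x. s x * besselJ \<mu> (of_real (\<omega> * g x)))
    = (\<Sum>j\<le>r. nderiv a b j s a / fact j * moment_M a b g j \<mu> \<omega>)
      + integral {a..b} (\<lambda>x. (s x - taylor_poly a b r s x a) * besselJ \<mu> (of_real (\<omega> * g x)))"
proof -
  define J where "J = (\<lambda>x. besselJ \<mu> (complex_of_real (\<omega> * g x)))"
  have int: "(\<lambda>x. \<phi> x * J x) integrable_on {a..b}" if "continuous_on {a..b} \<phi>" for \<phi>
    unfolding J_def using besselJ_integrable_on[OF \<mu> \<omega> that] .
  have conts: "continuous_on {a..b} s"
    by (rule smooth_on_interval_continuous[OF assms(1)])
  have mono: "(\<lambda>x. complex_of_real ((x - a) ^ j) * J x) integrable_on {a..b}" for j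
    by (intro int continuous_intros)
  have "integral {a..b} (\<lambda>x. taylor_poly a b r s x a * J x)
      = integral {a..b} (\<lambda>x. \<Sum>j\<le>r. nderiv a b j s a / fact j * (of_real ((x - a) ^ j) * J x))"
    by (simp only: taylor_poly_def sum_distrib_right mult.assoc)
  also have "\<dots> = (\<Sum>j\<le>r. integral {a..b} (\<lambda>x. nderiv a b j s a / fact j * (of_real ((x - a) ^ j) * J x)))"
    by (intro integral_sum finite_atMost integrable_on_mult_right mono)
  also have "\<dots> = (\<Sum>j\<le>r. nderiv a b j s a / fact j * moment_M a b g j \<mu> \<omega>)"
    by (simp only: integral_mult_right moment_M_def J_def)
  finally have T: "integral {a..b} (\<lambda>x. taylor_poly a b r s x a * J x)
      = (\<Sum>j\<le>r. nderiv a b j s a / fact j * moment_M a b g j \<mu> \<omega>)" .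
  have contT: "continuous_on {a..b} (\<lambda>x. taylor_poly a b r s x a)"
    unfolding taylor_poly_def by (intro continuous_intros)
  have "integral {a..b} (\<lambda>x. s x * J x)
      = integral {a..b} (\<lambda>x. taylor_poly a b r s x a * J x + (s x - taylor_poly a b r s x a) * J x)"
    by (simp add: algebra_simps)
  also have "\<dots> = integral {a..b} (\<lambda>x. taylor_poly a b r s x a * J x)
      + integral {a..b} (\<lambda>x. (s x - taylor_poly a b r s x a) * J x)"
    by (intro integral_add int continuous_intros conts contT)
  finally show ?thesis unfolding T by (simp only: J_def)
qed

text \<open>Eliminates the auxiliary functions: v is the next sigma on [a, b], and w(b) is the
  quotient in the boundary terms of the expansion.\<close>

lemma sigma_hat_by_parts:
  fixes f \<nu> k
  defines "s \<equiv> sigma_hat a b r \<nu> g f k" and "s' \<equiv> sigma_hat a b r \<nu> g f (Suc k)"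
    and "\<mu> \<equiv> \<nu> + of_nat k"
  assumes f: "smooth_on_interval a b f" and \<mu>: "Re \<mu> + 1 > 0" and \<omega>: "\<omega> > 0"
  shows "integral {a..b} (\<lambda>x. (s x - taylor_poly a b r s x a) * besselJ \<mu> (of_real (\<omega> * g x)))
    = 1 / of_real \<omega> * ((s b - taylor_poly a b r s b a) / of_real (dwithin a b g b)
          * besselJ (\<mu> + 1) (of_real (\<omega> * g b))
        - integral {a..b} (\<lambda>x. s' x * besselJ (\<mu> + 1) (of_real (\<omega> * g x))))"
proof -
  have Suc: "\<nu> + of_nat (Suc k) = \<mu> + 1" by (simp add: \<mu>_def add_ac)
  obtain w v where wv: "smooth_on_interval a b w" "smooth_on_interval a b v" "w a = 0"
    "\<And>x. x \<in> {a..b} \<Longrightarrow> s x - taylor_poly a b r s x a = w x * of_real (dwithin a b g x)"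
    "\<And>x. x \<in> {a<..b} \<Longrightarrow>
      v x = dwithin a b w x - (\<mu> + 1) * (w x * of_real (dwithin a b g x) / of_real (g x))"
    by (rule sigma_step[OF smooth_sigma_hat[OF f, of \<nu> k, folded s_def], of "\<mu> + 1"]) (rule that)
  have s': "s' x = v x" if "x \<in> {a..b}" for x
    unfolding s'_def
    by (rule sigma_hat_Suc_eq[OF wv(1-3)]) (use wv(4,5) that Suc in \<open>simp_all add: s_def\<close>)
  have "b \<in> {a<..b}" "b \<in> {a..b}" using less by auto
  then have wb: "(s b - taylor_poly a b r s b a) / of_real (dwithin a b g b) = w b"
    using wv(4)[of b] dg_nonzero[of b] by simp
  have "integral {a..b} (\<lambda>x. (s x - taylor_poly a b r s x a) * besselJ \<mu> (of_real (\<omega> * g x)))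
      = integral {a..b} (\<lambda>x. w x * of_real (dwithin a b g x) * besselJ \<mu> (of_real (\<omega> * g x)))"
    by (intro integral_cong) (simp only: wv(4))
  also have "\<dots> = 1 / of_real \<omega> * (w b * besselJ (\<mu> + 1) (of_real (\<omega> * g b))
        - integral {a..b} (\<lambda>x. v x * besselJ (\<mu> + 1) (of_real (\<omega> * g x))))"
    by (rule integral_unique[OF has_integral_by_parts[OF wv(1-3,5) \<omega> \<mu>]])
  also have "integral {a..b} (\<lambda>x. v x * besselJ (\<mu> + 1) (of_real (\<omega> * g x)))
      = integral {a..b} (\<lambda>x. s' x * besselJ (\<mu> + 1) (of_real (\<omega> * g x)))"
    by (intro integral_cong) (simp only: s')
  finally show ?thesis unfolding wb .
qed

text \<open>The Bessel factor is bounded on the whole real line, so the bound does not depend on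
  omega. This closes the remainder estimate.\<close>

lemma integral_besselJ_bounded:
  assumes s: "continuous_on {a..b} s" and \<mu>: "Re \<mu> > 0"
  obtains K where "\<And>\<omega>. norm (integral {a..b} (\<lambda>x. s x * besselJ \<mu> (of_real (\<omega> * g x)))) \<le> K"
proof -
  obtain B where B: "\<And>y. norm (besselJ \<mu> (of_real y)) \<le> B"
    using bounded_besselJ_of_real[OF \<mu>] by blast
  have "bounded (s ` {a..b})"
    by (intro compact_imp_bounded compact_continuous_image s) simp
  then obtain M where M: "\<And>x. x \<in> {a..b} \<Longrightarrow> norm (s x) \<le> M"
    unfolding bounded_iff by blast
  have M0: "M \<ge> 0" using order_trans[OF norm_ge_zero M[of a]] less by simp
  have "norm (integral {a..b} (\<lambda>x. s x * besselJ \<mu> (of_real (\<omega> * g x)))) \<le> M * B * (b - a)" for \<omega>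
  proof (rule integral_bound)
    show "continuous_on {a..b} (\<lambda>x. s x * besselJ \<mu> (of_real (\<omega> * g x)))"
      by (intro continuous_on_mult s continuous_on_compose2[OF continuous_on_besselJ_of_real[of \<mu> UNIV]]
          continuous_on_const smooth_on_interval_continuous[OF smooth_g] \<mu>) auto
    show "norm (s x * besselJ \<mu> (of_real (\<omega> * g x))) \<le> M * B" if "x \<in> {a..b}" for x
      unfolding norm_mult by (intro mult_mono M B that M0) auto
  qed (use less in auto)
  then show ?thesis by (rule that)
qed

end

section \<open>Factoring the phase and assembling the expansion\<close>

lemma hankel_phase_factorization:
  assumes "a < b" "smooth_on_interval a b g" "g a = 0"
    and "\<forall>j\<in>{1..r}. nderiv a b j g a = 0" "nderiv a b (Suc r) g a \<noteq> 0"
    and nz: "\<forall>x\<in>{a<..b}. g x \<noteq> 0 \<and> dwithin a b g x \<noteq> 0"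
  obtains p q where "hankel_phase a b r g p q"
proof -
  let ?g = "\<lambda>x. complex_of_real (g x)" and ?g' = "\<lambda>x. complex_of_real (dwithin a b g x)"
  have mem: "a \<in> {a..b}" using assms by auto
  \<comment> \<open>The Taylor coefficients of g below order r + 1, and those of g' below order r,
    vanish at a, so only the remainder terms of the two Taylor formulas survive.\<close>
  have z: "nderiv a b j ?g a = 0" if "j < Suc r" for j
    using assms(3,4) that smooth_on_interval_of_real(1)[OF assms(1,2) mem, where 'a = complex]
    by (cases j) auto
  have z': "nderiv a b j ?g' a = 0" if "j < r" for j
    using bspec[OF assms(4), of "Suc j"] that nderiv_Suc'[of a b j g]
      smooth_on_interval_of_real(1)[OF assms(1) smooth_on_interval_dwithin[OF assms(2)] mem, where 'a = complex]
    by auto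
  obtain p where p: "smooth_on_interval a b p"
    "\<And>x. x \<in> {a..b} \<Longrightarrow> ?g x = (\<Sum>j<Suc r. nderiv a b j ?g a / fact j * of_real ((x - a) ^ j))
      + of_real ((x - a) ^ Suc r) * p x" "p a = nderiv a b (Suc r) ?g a / fact (Suc r)"
    by (rule smooth_on_interval_Taylor[OF assms(1) smooth_on_interval_of_real(2)[OF assms(1,2)],
        where n = "Suc r"]) (rule that)
  obtain q where q: "smooth_on_interval a b q"
    "\<And>x. x \<in> {a..b} \<Longrightarrow> ?g' x = (\<Sum>j<r. nderiv a b j ?g' a / fact j * of_real ((x - a) ^ j))
      + of_real ((x - a) ^ r) * q x" "q a = nderiv a b r ?g' a / fact r"
    by (rule smooth_on_interval_Taylor[OF assms(1)
        smooth_on_interval_of_real(2)[OF assms(1) smooth_on_interval_dwithin[OF assms(2)]], where n = r]) (rule that)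
  have g_eq: "?g x = of_real ((x - a) ^ Suc r) * p x" if "x \<in> {a..b}" for x
    using p(2)[OF that] z by simp
  have g'_eq: "?g' x = of_real ((x - a) ^ r) * q x" if "x \<in> {a..b}" for x
    using q(2)[OF that] z' by simp
  \<comment> \<open>p(a) and q(a) are nonzero multiples of the derivative of g of order r + 1 at a.
    Elsewhere zeros of p and q would be zeros of g and g'.\<close>
  have "p a \<noteq> 0"
    using p(3) assms(5) smooth_on_interval_of_real(1)[OF assms(1,2) mem, where 'a = complex]
    by (simp del: fact_Suc)
  moreover have "q a \<noteq> 0"
    using q(3) assms(5) nderiv_Suc'[of a b r g]
      smooth_on_interval_of_real(1)[OF assms(1) smooth_on_interval_dwithin[OF assms(2)] mem, where 'a = complex]
    by simp
  moreover have "p x \<noteq> 0 \<and> q x \<noteq> 0" if "x \<in> {a<..b}" for x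
    using g_eq[of x] g'_eq[of x] nz that by force
  ultimately have "p x \<noteq> 0 \<and> q x \<noteq> 0" if "x \<in> {a..b}" for x
    using that by (cases "x = a") auto
  then have "hankel_phase a b r g p q"
    using assms(1,2) p(1) q(1) g_eq g'_eq by unfold_locales auto
  then show ?thesis by (rule that)
qed

text \<open>The algebra of the expansion, with z = -omega: \<open>L\<close> is the full integral at
  level k, \<open>S\<close> the moment sum, \<open>I\<close> the integral left after the Taylor
  subtraction, \<open>B\<close> the boundary term. Each step replaces I by the next level.\<close>

lemma telescoped_remainder:
  fixes z :: "'a::field"
  assumes "z \<noteq> 0"
    and "\<And>k. L k = S k + I k"
    and "\<And>k. I k = (- 1 / z) * (B (Suc k) - L (Suc k))"
  shows "L 0 - (\<Sum>k\<le>N. (1 / z ^ k) * S k) + (\<Sum>k\<in>{1..N}. (1 / z ^ k) * B k) = I N / z ^ N"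
proof (induction N)
  case 0
  then show ?case using assms(2)[of 0] by simp
next
  case (Suc N)
  have "L 0 - (\<Sum>k\<le>Suc N. (1 / z ^ k) * S k) + (\<Sum>k\<in>{1..Suc N}. (1 / z ^ k) * B k)
      = I N / z ^ N + (B (Suc N) - S (Suc N)) / z ^ Suc N"
    using Suc by (simp add: algebra_simps diff_divide_distrib)
  also have "\<dots> = I (Suc N) / z ^ Suc N"
    unfolding assms(3)[of N] assms(2)[of "Suc N"] using assms(1) by (simp add: field_simps)
  finally show ?case .
qed

theorem theorem3p2:
  fixes r :: nat and \<nu> :: complex and a b :: real and f g :: "real \<Rightarrow> real"
  assumes "r \<ge> 1"
    and "Re \<nu> > - 1 / (real r + 1)"
    and "a < b"
    and "smooth_on_interval a b f"
    and "smooth_on_interval a b g"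
    and "g a = 0"
    and "\<forall>j\<in>{1..r}. nderiv a b j g a = 0"
    and "nderiv a b (Suc r) g a \<noteq> 0"
    and "\<forall>x\<in>{a<..b}. g x \<noteq> 0 \<and> dwithin a b g x \<noteq> 0"
  shows "\<forall>N::nat. (\<lambda>\<omega>. hankel_H a b \<nu> g f \<omega>
      - (\<Sum>k\<le>N. (1 / complex_of_real ((- \<omega>) ^ k)) *
           (\<Sum>j\<le>r. nderiv a b j (sigma_hat a b r \<nu> g f k) a / fact j * moment_M a b g j (\<nu> + of_nat k) \<omega>))
      + (\<Sum>k\<in>{1..N}. (1 / complex_of_real ((- \<omega>) ^ k)) *
           ((sigma_hat a b r \<nu> g f (k - 1) b - taylor_poly a b r (sigma_hat a b r \<nu> g f (k - 1)) b a)
              / complex_of_real (dwithin a b g b)) *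
           besselJ (\<nu> + of_nat k) (complex_of_real (\<omega> * g b))))
    \<in> O[at_top](\<lambda>\<omega>. complex_of_real (\<omega> powr (- (real N + 1))))"
proof
  fix N :: nat
  obtain p q where "hankel_phase a b r g p q"
    using hankel_phase_factorization assms(3,5-9) by metis
  then interpret hankel_phase a b r g p q .
  define s where "s = sigma_hat a b r \<nu> g f"
  define J where "J = (\<lambda>k \<omega> x. besselJ (\<nu> + of_nat k) (complex_of_real (\<omega> * g x)))"
  define L where "L = (\<lambda>k \<omega>. integral {a..b} (\<lambda>x. s k x * J k \<omega> x))"
  define I where "I = (\<lambda>k \<omega>. integral {a..b} (\<lambda>x. (s k x - taylor_poly a b r (s k) x a) * J k \<omega> x))"
  define S where "S = (\<lambda>k \<omega>. \<Sum>j\<le>r. nderiv a b j (s k) a / fact j * moment_M a b g j (\<nu> + of_nat k) \<omega>)"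
  define c where "c = (\<lambda>k. (s (k - 1) b - taylor_poly a b r (s (k - 1)) b a) / complex_of_real (dwithin a b g b))"
  have smooth_s: "smooth_on_interval a b (s k)" for k
    unfolding s_def by (rule smooth_sigma_hat[OF assms(4)])
  \<comment> \<open>The integrability condition at order nu is passed on to nu + k, whose real part
    is no smaller.\<close>
  have ind: "real (Suc r) * Re (\<nu> + of_nat k) > -1" for k
  proof -
    have "- 1 < real (Suc r) * Re \<nu>" using assms(2) by (simp add: field_simps)
    also have "\<dots> \<le> real (Suc r) * Re (\<nu> + of_nat k)" by (intro mult_left_mono) auto
    finally show ?thesis .
  qed
  have pos: "Re (\<nu> + of_nat k) + 1 > 0" for k
  proof -
    have "- 1 \<le> - 1 / (real r + 1)" by (simp add: field_simps)
    then have "- 1 < Re \<nu>" using assms(2) by linarith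
    then show ?thesis by simp
  qed
  have L: "L k \<omega> = S k \<omega> + I k \<omega>" if "\<omega> > 0" for k \<omega>
    unfolding L_def S_def I_def J_def by (rule Taylor_moments[OF smooth_s ind that])
  have I: "I k \<omega> = 1 / of_real \<omega> * (c (Suc k) * J (Suc k) \<omega> b - L (Suc k) \<omega>)" if "\<omega> > 0" for k \<omega>
    using sigma_hat_by_parts[OF assms(4) pos that, of k]
    unfolding I_def J_def L_def s_def c_def by (simp add: add_ac)
  obtain K where K: "\<And>\<omega>. norm (L (Suc N) \<omega>) \<le> K"
    using integral_besselJ_bounded[OF smooth_on_interval_continuous[OF smooth_s], of "\<nu> + of_nat (Suc N)"]
      pos[of N] unfolding L_def J_def by (auto simp: add_ac)
  obtain B where B: "\<And>y. norm (besselJ (\<nu> + of_nat (Suc N)) (of_real y)) \<le> B"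
    using bounded_besselJ_of_real[of "\<nu> + of_nat (Suc N)"] pos[of N] by (auto simp: add_ac)
  let ?R = "\<lambda>\<omega>. hankel_H a b \<nu> g f \<omega>
      - (\<Sum>k\<le>N. (1 / complex_of_real ((- \<omega>) ^ k)) * S k \<omega>)
      + (\<Sum>k\<in>{1..N}. (1 / complex_of_real ((- \<omega>) ^ k)) * c k * J k \<omega> b)"
  have R: "norm (?R \<omega>) \<le> (norm (c (Suc N)) * B + K) * norm (complex_of_real (\<omega> powr (- (real N + 1))))"
    if \<omega>: "\<omega> > 0" for \<omega>
  proof -
    have powr: "\<omega> powr (- (real N + 1)) = 1 / \<omega> ^ Suc N"
      using powr_minus_divide[of \<omega> "real N + 1"] powr_realpow[OF \<omega>, of "Suc N"]
      by (simp only: of_nat_Suc add.commute)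
    have H: "hankel_H a b \<nu> g f \<omega> = L 0 \<omega>"
      by (simp add: hankel_H_def L_def s_def J_def)
    \<comment> \<open>The factor 1 / omega is written as -1 / (-omega) to fit the telescoping in
      powers of -omega.\<close>
    have Ik: "I k \<omega> = (- 1 / complex_of_real (- \<omega>)) * (c (Suc k) * J (Suc k) \<omega> b - L (Suc k) \<omega>)" for k
      unfolding I[OF \<omega>, of k] by simp
    have "complex_of_real (- \<omega>) \<noteq> 0" using \<omega> by simp
    from telescoped_remainder[where L = "\<lambda>k. L k \<omega>" and S = "\<lambda>k. S k \<omega>" and I = "\<lambda>k. I k \<omega>"
        and B = "\<lambda>k. c k * J k \<omega> b" and N = N, OF this L[OF \<omega>] Ik]
    have "?R \<omega> = I N \<omega> / complex_of_real (- \<omega>) ^ N"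
      by (simp only: H of_real_power mult.assoc)
    \<comment> \<open>One more integration by parts than there are subtracted boundary terms: it
      supplies the extra factor 1 / omega, and what remains is bounded because Re nu + N + 1 >
      0.\<close>
    also have "norm \<dots> = norm (c (Suc N) * J (Suc N) \<omega> b - L (Suc N) \<omega>) / \<omega> ^ Suc N"
      unfolding I[OF \<omega>] using \<omega> by (simp add: norm_mult norm_divide norm_power)
    also have "\<dots> \<le> (norm (c (Suc N)) * B + K) / \<omega> ^ Suc N"
    proof (rule divide_right_mono)
      have "norm (c (Suc N) * J (Suc N) \<omega> b) \<le> norm (c (Suc N)) * B"
        unfolding norm_mult J_def by (intro mult_left_mono B) auto
      then show "norm (c (Suc N) * J (Suc N) \<omega> b - L (Suc N) \<omega>) \<le> norm (c (Suc N)) * B + K"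
        using norm_triangle_ineq4[of "c (Suc N) * J (Suc N) \<omega> b" "L (Suc N) \<omega>"] K[of \<omega>] by linarith
    qed (use \<omega> in auto)
    also have "(norm (c (Suc N)) * B + K) / \<omega> ^ Suc N
        = (norm (c (Suc N)) * B + K) * norm (complex_of_real (\<omega> powr (- (real N + 1))))"
      unfolding powr norm_of_real using \<omega> by simp
    finally show ?thesis .
  qed
  have "?R \<in> O[at_top](\<lambda>\<omega>. complex_of_real (\<omega> powr (- (real N + 1))))"
    by (rule bigoI[of _ "norm (c (Suc N)) * B + K"])
      (use R in \<open>auto intro: eventually_mono[OF eventually_gt_at_top[of 0]]\<close>)
  then show "(\<lambda>\<omega>. hankel_H a b \<nu> g f \<omega>
      - (\<Sum>k\<le>N. (1 / complex_of_real ((- \<omega>) ^ k)) *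
           (\<Sum>j\<le>r. nderiv a b j (sigma_hat a b r \<nu> g f k) a / fact j * moment_M a b g j (\<nu> + of_nat k) \<omega>))
      + (\<Sum>k\<in>{1..N}. (1 / complex_of_real ((- \<omega>) ^ k)) *
           ((sigma_hat a b r \<nu> g f (k - 1) b - taylor_poly a b r (sigma_hat a b r \<nu> g f (k - 1)) b a)
              / complex_of_real (dwithin a b g b)) *
           besselJ (\<nu> + of_nat k) (complex_of_real (\<omega> * g b))))
    \<in> O[at_top](\<lambda>\<omega>. complex_of_real (\<omega> powr (- (real N + 1))))"
    unfolding S_def c_def s_def J_def .
qed

end
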